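(* Let $p$ be a positive integer. Consider on $M=\mathbb{R}^3$ the distribution $\Delta=\mathrm{span}\{f_1,f_2\}$, where $$f_1=\frac{\partial}{\partial x_1}\quad\text{and}\quad f_2=(1-x_1)\frac{\partial}{\partial x_2}+x_1^p\frac{\partial}{\partial x_3},$$ and fix on $\Delta$ the metric $g$ that makes $f_1$ and $f_2$ orthonormal. Let $\gamma$ be the curve $t\mapsto\gamma(t)=(0,t,0)$. Then: (i) For any $p\geq 2$ the curve $\gamma$ is a strictly singular extremal in $(\mathbb{R}^3,\Delta)$. (ii) If $p$ is an even integer then $\gamma$ is locally length-minimizing in $(\mathbb{R}^3,\Delta,g)$. (iii) If $p=3$ then $\gamma$ is not locally length-minimizing in $(\mathbb{R}^3,\Delta,g)$.
   Context: An absolutely continuous curve $\eta:[a,b]\to\mathbb{R}^3$ is horizontal (admissible) with control $u\in L^1([a,b];\mathbb{R}^2)$ if $\dot\eta=u_1f_1(\eta)+u_2f_2(\eta)$ a.e.; its length is $\|u\|_{L^1([a,b];\mathbb{R}^2)}$. It is length-minimizing if its length is minimal among horizontal curves with the same end-points. A curve defined on an interval $I$ is locally length-minimizing if every $t\in I$ has a neighborhood in $I$ such that the restriction of the curve to every compact subinterval of that neighborhood is length-minimizing. The curve $\gamma$ is considered for $t\in[0,1]$; it has control $u=(0,1)$. Let $X=L^1([0,1];\mathbb{R}^2)$. The end-point map from $q_0\in \mathbb{R}^3$ is $F:X\to\mathbb{R}^3$, $F(u)=\eta(1)$, where $\dot\eta=u_1f_1(\eta)+u_2f_2(\eta)$,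 $\eta(0)=q_0$. Let $J(u)=\|u\|_{L^1([0,1];\mathbb{R}^2)}$ and let $\mathcal{F}=(F,J):X\to\mathbb{R}^3\times\mathbb{R}$ be the extended end-point map, with $d_u\mathcal F=(d_uF,d_uJ)$, where $d_uJ(v)$ is the directional derivative of $J$ at $u$ in direction $v$. A horizontal curve with control $u$ is an extremal if $u$ is a critical point of $\mathcal{F}$, i.e. there is a nonzero $(\lambda,\lambda_0)\in\mathrm{Im}(d_u\mathcal{F})^\perp\subset (\mathbb{R}^3)^*\times\mathbb{R}$ (pairs annihilating $\mathrm{Im}(d_u\mathcal{F})$). It is a singular extremal if there is such a nonzero pair with $\lambda_0=0$, and a strictly singular extremal if it is an extremal and $\lambda_0=0$ for every $(\lambda,\lambda_0)\in\mathrm{Im}(d_u\mathcal{F})^\perp$. Here $q_0=\gamma(0)=0$. *)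

theory Defs
  imports "HOL-Analysis.Analysis"
begin

section \<open>Horizontal curves and their length\<close>

definition f1 :: "real^3 \<Rightarrow> real^3" where
  "f1 x = vector [1, 0, 0]"

definition f2 :: "nat \<Rightarrow> real^3 \<Rightarrow> real^3" where
  "f2 p x = vector [0, 1 - x$1, (x$1) ^ p]"

definition gam :: "real \<Rightarrow> real^3" where
  "gam t = vector [0, t, 0]"

text \<open>
  The members of a division are possibly degenerate compact intervals with pairwise disjoint
  interiors, so \<^term>\<open>D\<close> ranges over the finite families of nonoverlapping compact subintervals
  of \<^term>\<open>{a..b}\<close>; \<^term>\<open>Inf k\<close> and \<^term>\<open>Sup k\<close> are the end-points of \<^term>\<open>k\<close>.
\<close>

definition abs_continuous_on :: "real \<Rightarrow> real \<Rightarrow> (real \<Rightarrow> 'a::real_normed_vector) \<Rightarrow> bool" where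
  "abs_continuous_on a b f \<longleftrightarrow>
     (\<forall>\<epsilon>>0. \<exists>\<delta>>0. \<forall>D. D division_of \<Union>D \<and> \<Union>D \<subseteq> {a..b} \<and> (\<Sum>k\<in>D. Sup k - Inf k) < \<delta>
        \<longrightarrow> (\<Sum>k\<in>D. norm (f (Sup k) - f (Inf k))) < \<epsilon>)"

definition horizontal :: "nat \<Rightarrow> real \<Rightarrow> real \<Rightarrow> (real \<Rightarrow> real^3) \<Rightarrow> (real \<Rightarrow> real^2) \<Rightarrow> bool" where
  "horizontal p a b \<eta> u \<longleftrightarrow>
     abs_continuous_on a b \<eta> \<and> integrable (lebesgue_on {a..b}) u \<and>
     (AE t in lebesgue_on {a..b}.
        (\<eta> has_vector_derivative (u t $ 1 *\<^sub>R f1 (\<eta> t) + u t $ 2 *\<^sub>R f2 p (\<eta> t)))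
          (at t within {a..b}))"

text \<open>
  The fields \<^const>\<open>f1\<close> and \<^const>\<open>f2\<close> are linearly independent at every point and orthonormal
  for the metric, so the speed of a horizontal curve is the Euclidean norm of its control.
\<close>

definition L1_norm :: "real \<Rightarrow> real \<Rightarrow> (real \<Rightarrow> real^2) \<Rightarrow> real" where
  "L1_norm a b u = (LINT t|lebesgue_on {a..b}. norm (u t))"

text \<open>
  Length does not depend on the parametrization, and the competitors are all horizontal curves
  with the same end-points, on any compact interval.
\<close>

definition length_minimizing :: "nat \<Rightarrow> real \<Rightarrow> real \<Rightarrow> (real \<Rightarrow> real^3) \<Rightarrow> bool" where
  "length_minimizing p a b \<eta> \<longleftrightarrow>
     (\<exists>u. horizontal p a b \<eta> u \<and>
        (\<forall>c d \<zeta> v. c \<le> d \<and> horizontal p c d \<zeta> v \<and> \<zeta> c = \<eta> a \<and> \<zeta> d = \<eta> b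
           \<longrightarrow> L1_norm a b u \<le> L1_norm c d v))"

definition locally_length_minimizing :: "nat \<Rightarrow> real set \<Rightarrow> (real \<Rightarrow> real^3) \<Rightarrow> bool" where
  "locally_length_minimizing p I \<eta> \<longleftrightarrow>
     (\<forall>t\<in>I. \<exists>N. openin (top_of_set I) N \<and> t \<in> N \<and>
        (\<forall>a b. a \<le> b \<and> {a..b} \<subseteq> N \<longrightarrow> length_minimizing p a b \<eta>))"


section \<open>The Banach space \<open>X = L\<^sup>1([0,1]; \<real>\<^sup>2)\<close>\<close>

definition L1_eq :: "(real \<Rightarrow> real^2) \<Rightarrow> (real \<Rightarrow> real^2) \<Rightarrow> bool" where
  "L1_eq u v \<longleftrightarrow> integrable (lebesgue_on {0..1}) u \<and> integrable (lebesgue_on {0..1}) v \<and>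
     (AE t in lebesgue_on {0..1}. u t = v t)"

lemma part_equivp_L1_eq: "part_equivp L1_eq"
proof (rule part_equivpI)
  show "\<exists>x. L1_eq x x"
    by (rule exI[of _ "\<lambda>_. 0"]) (simp add: L1_eq_def)
  show "symp L1_eq"
    by (auto simp: symp_def L1_eq_def elim: AE_mp)
  show "transp L1_eq"
    unfolding transp_def L1_eq_def by (auto elim!: AE_mp)
qed

quotient_type control = "real \<Rightarrow> real^2" / partial: L1_eq
  by (rule part_equivp_L1_eq)

instantiation control :: real_normed_vector
begin

lift_definition zero_control :: control is "\<lambda>_. 0"
  by (simp add: L1_eq_def)

lift_definition plus_control :: "control \<Rightarrow> control \<Rightarrow> control" is "\<lambda>u v t. u t + v t"
  unfolding L1_eq_def by (auto elim!: AE_mp)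

lift_definition minus_control :: "control \<Rightarrow> control \<Rightarrow> control" is "\<lambda>u v t. u t - v t"
  unfolding L1_eq_def by (auto elim!: AE_mp)

lift_definition uminus_control :: "control \<Rightarrow> control" is "\<lambda>u t. - u t"
  unfolding L1_eq_def by (auto elim!: AE_mp)

lift_definition scaleR_control :: "real \<Rightarrow> control \<Rightarrow> control" is "\<lambda>r u t. r *\<^sub>R u t"
  unfolding L1_eq_def by (auto elim!: AE_mp)

lift_definition norm_control :: "control \<Rightarrow> real" is "L1_norm 0 1"
  unfolding L1_eq_def L1_norm_def
  by (intro integral_cong_AE) (auto elim!: AE_mp)

definition sgn_control :: "control \<Rightarrow> control" where
  "sgn_control u = inverse (norm u) *\<^sub>R u"

definition dist_control :: "control \<Rightarrow> control \<Rightarrow> real" where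
  "dist_control u v = norm (u - v)"

definition uniformity_control :: "(control \<times> control) filter" where
  "uniformity_control = (INF e\<in>{0<..}. principal {(u, v). dist u v < e})"

definition open_control :: "control set \<Rightarrow> bool" where
  "open_control U \<longleftrightarrow> (\<forall>u\<in>U. eventually (\<lambda>(u', v). u' = u \<longrightarrow> v \<in> U) uniformity)"

instance
proof
  fix u v w :: control and r s :: real
  show "u + v + w = u + (v + w)"
    by transfer (auto simp: L1_eq_def add.assoc)
  show "u + v = v + u"
    by transfer (auto simp: L1_eq_def add.commute)
  show "0 + u = u"
    by transfer (auto simp: L1_eq_def)
  show "- u + u = 0"
    by transfer (auto simp: L1_eq_def)
  show "u - v = u + - v"
    by transfer (auto simp: L1_eq_def)
  show "r *\<^sub>R (u + v) = r *\<^sub>R u + r *\<^sub>R v"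
    by transfer (auto simp: L1_eq_def scaleR_add_right)
  show "(r + s) *\<^sub>R u = r *\<^sub>R u + s *\<^sub>R u"
    by transfer (auto simp: L1_eq_def scaleR_add_left)
  show "r *\<^sub>R s *\<^sub>R u = (r * s) *\<^sub>R u"
    by transfer (auto simp: L1_eq_def)
  show "1 *\<^sub>R u = u"
    by transfer (auto simp: L1_eq_def)
  show "sgn u = inverse (norm u) *\<^sub>R u"
    by (rule sgn_control_def)
  show "dist u v = norm (u - v)"
    by (rule dist_control_def)
  show "(uniformity :: (control \<times> control) filter) = (INF e\<in>{0<..}. principal {(u, v). dist u v < e})"
    by (rule uniformity_control_def)
  show "open U \<longleftrightarrow> (\<forall>u\<in>U. eventually (\<lambda>(u', v). u' = u \<longrightarrow> v \<in> U) uniformity)" for U :: "control set"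
    by (rule open_control_def)
  show "norm u = 0 \<longleftrightarrow> u = 0"
    by transfer (auto simp: L1_eq_def L1_norm_def integral_nonneg_eq_0_iff_AE)
  show "norm (u + v) \<le> norm u + norm v"
  proof transfer
    fix u v :: "real \<Rightarrow> real^2"
    assume "L1_eq u u" "L1_eq v v"
    then have i: "integrable (lebesgue_on {0..1}) u" "integrable (lebesgue_on {0..1}) v"
      by (auto simp: L1_eq_def)
    have "L1_norm 0 1 (\<lambda>t. u t + v t) \<le> (LINT t|lebesgue_on {0..1}. norm (u t) + norm (v t))"
      unfolding L1_norm_def using i by (intro integral_mono) (auto intro: norm_triangle_ineq)
    also have "\<dots> = L1_norm 0 1 u + L1_norm 0 1 v"
      unfolding L1_norm_def using i by simp
    finally show "L1_norm 0 1 (\<lambda>t. u t + v t) \<le> L1_norm 0 1 u + L1_norm 0 1 v" .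
  qed
  show "norm (r *\<^sub>R u) = \<bar>r\<bar> * norm u"
    by transfer (simp add: L1_norm_def)
qed

end


section \<open>End-point map and extremals\<close>

text \<open>
  Horizontality depends on the control only up to equality almost everywhere, so the choice of
  the representative \<^term>\<open>rep_control u\<close> is immaterial.
\<close>

definition endpoint_map :: "nat \<Rightarrow> real^3 \<Rightarrow> control \<Rightarrow> real^3" where
  "endpoint_map p q0 u = (THE q. \<exists>\<eta>. horizontal p 0 1 \<eta> (rep_control u) \<and> \<eta> 0 = q0 \<and> \<eta> 1 = q)"

definition J :: "control \<Rightarrow> real" where
  "J u = norm u"

text \<open>
  \<^const>\<open>J\<close> is convex but not Frechet differentiable; its one-sided directional derivatives
  always exist.
\<close>

definition dJ :: "control \<Rightarrow> control \<Rightarrow> real" where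
  "dJ u v = Lim (at_right 0) (\<lambda>h. (J (u + h *\<^sub>R v) - J u) / h)"

definition d_ext_endpoint :: "nat \<Rightarrow> real^3 \<Rightarrow> control \<Rightarrow> control \<Rightarrow> (real^3) \<times> real" where
  "d_ext_endpoint p q0 u v = (frechet_derivative (endpoint_map p q0) (at u) v, dJ u v)"

definition annihilator :: "((real^3) \<times> real) set \<Rightarrow> (((real^3) \<Rightarrow>\<^sub>L real) \<times> real) set" where
  "annihilator S = {(l, l0). \<forall>(x, r)\<in>S. blinfun_apply l x + l0 * r = 0}"

abbreviation multipliers :: "nat \<Rightarrow> real^3 \<Rightarrow> control \<Rightarrow> (((real^3) \<Rightarrow>\<^sub>L real) \<times> real) set" where
  "multipliers p q0 u \<equiv> annihilator (range (d_ext_endpoint p q0 u))"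

text \<open>
  As \<^const>\<open>f1\<close> and \<^const>\<open>f2\<close> are linearly independent at every point, a horizontal curve has
  exactly one control in \<^typ>\<open>control\<close>.
\<close>

definition extremal :: "nat \<Rightarrow> (real \<Rightarrow> real^3) \<Rightarrow> control \<Rightarrow> bool" where
  "extremal p \<eta> u \<longleftrightarrow> horizontal p 0 1 \<eta> (rep_control u) \<and> (\<exists>m\<in>multipliers p (\<eta> 0) u. m \<noteq> 0)"

definition strictly_singular_extremal :: "nat \<Rightarrow> (real \<Rightarrow> real^3) \<Rightarrow> bool" where
  "strictly_singular_extremal p \<eta> \<longleftrightarrow>
     (\<exists>u. extremal p \<eta> u \<and> (\<forall>(l, l0)\<in>multipliers p (\<eta> 0) u. l0 = 0))"

end

theory Submission
  imports Defs
begin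

text \<open>
  Write \<open>x\<close> for the first coordinate of a horizontal curve with control \<open>u\<close>. The equations are
  triangular: \<open>x\<close> is the integral of \<open>u\<^sub>1\<close>, and the other two coordinates are the integrals of
  \<open>u\<^sub>2 (1 - x)\<close> and \<open>u\<^sub>2 x\<^sup>p\<close>, so everything reduces to estimates of these integrals.

  (i) For \<open>p \<ge> 2\<close> the third coordinate has zero differential at the control \<open>(0,1)\<close>, which yields the
  multiplier \<open>dx\<^sub>3\<close>. Testing with the variations \<open>(1,0)\<close>, \<open>(t,0)\<close> (along which the length is
  stationary) and \<open>(0,1)\<close> forces the remaining components of a multiplier, \<open>\<lambda>\<^sub>0\<close> included, to vanish.

  (ii) A competitor of length \<open>L\<close> between points at distance \<open>l\<close> on the line satisfies
  \<open>L - l = C + \<integral>u\<^sub>2 x\<close> with the excess \<open>C = \<integral>(|u| - u\<^sub>2) \<ge> 0\<close>. If \<open>p\<close> is even, then \<open>\<integral>u\<^sub>2 x\<^sup>p = 0\<close>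
  forces \<open>max |x| \<le> 2\<^bsup>p+1\<^esup> C\<close>, so the second term cannot outweigh \<open>C\<close> once \<open>L\<close> is small.

  (iii) If \<open>p = 3\<close>, there are profiles \<open>\<phi>\<close> with \<open>\<integral>\<phi>\<^sup>3 = 0\<close> and \<open>\<integral>\<phi> < 0\<close>; for \<open>x = \<delta>\<phi>\<close> the gain
  \<open>-\<delta>\<integral>\<phi>\<close> is of order \<open>\<delta>\<close>, while the excess is of order \<open>\<delta>\<^sup>2\<close>.
\<close>

section \<open>Absolutely continuous functions and the fundamental theorem of calculus\<close>

lemma integrable_lebesgue_on_iff_absolutely_integrable:
  fixes f :: "'a::euclidean_space \<Rightarrow> 'b::euclidean_space"
  assumes "S \<in> sets lebesgue"
  shows "integrable (lebesgue_on S) f \<longleftrightarrow> f absolutely_integrable_on S"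
  using assms by (simp add: set_integrable_def integrable_restrict_space)

lemma negligible_Collect_not_AE_lebesgue_on:
  fixes S :: "'a::euclidean_space set"
  assumes "AE t in lebesgue_on S. P t" "S \<in> sets lebesgue"
  shows "negligible {t\<in>S. \<not> P t}"
proof -
  have "AE t in lebesgue. t \<in> S \<longrightarrow> P t"
    using assms by (simp add: AE_restrict_space_iff)
  then obtain N where "{t. \<not> (t \<in> S \<longrightarrow> P t)} \<subseteq> N" "N \<in> null_sets lebesgue"
    by (auto simp: eventually_ae_filter)
  then have "negligible N" "{t\<in>S. \<not> P t} \<subseteq> N"
    by (auto simp: negligible_iff_null_sets)
  then show ?thesis
    by (rule negligible_subset)
qed

lemma AE_lebesgue_on_negligibleI:
  fixes S :: "'a::euclidean_space set"
  assumes "negligible N" "\<And>t. t \<in> S - N \<Longrightarrow> P t" "S \<in> sets lebesgue"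
  shows "AE t in lebesgue_on S. P t"
proof -
  have "AE t in lebesgue. t \<in> S \<longrightarrow> P t"
    using assms by (intro AE_I'[of N]) (auto simp: negligible_iff_null_sets)
  then show ?thesis
    using assms by (simp add: AE_restrict_space_iff)
qed

text \<open>Nonoverlapping intervals meet only in null sets, so their contents add up to the measure
  of the union, which lies in \<open>T\<close>.\<close>

lemma sum_measure_division_le:
  fixes D :: "'a::euclidean_space set set"
  assumes D: "D division_of \<Union>D" and sub: "\<Union>D \<subseteq> T" and T: "T \<in> lmeasurable"
  shows "sum (measure lborel) D \<le> measure lebesgue T"
proof -
  note d = division_ofD[OF D]
  have "sum (measure lborel) D = measure lebesgue (\<Union>D)"
  proof -
    have "measure lborel k = measure lebesgue k" if "k \<in> D" for k
      using d(4)[OF that] by auto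
    then show ?thesis
      using content_division[OF D] by simp
  qed
  also have "\<dots> \<le> measure lebesgue T"
    using sub T D by (intro measure_mono_fmeasurable) (auto intro!: sets.finite_Union d(1) dest!: d(4))
  finally show ?thesis .
qed

lemma abs_continuous_onE:
  assumes "abs_continuous_on a b f" "\<epsilon> > 0"
  obtains \<delta> where "\<delta> > 0" "\<And>D. D division_of \<Union>D \<Longrightarrow> \<Union>D \<subseteq> {a..b} \<Longrightarrow>
    (\<Sum>k\<in>D. Sup k - Inf k) < \<delta> \<Longrightarrow> (\<Sum>k\<in>D. norm (f (Sup k) - f (Inf k))) < \<epsilon>"
proof -
  obtain \<delta> where \<delta>: "\<delta> > 0" "\<forall>D. D division_of \<Union>D \<and> \<Union>D \<subseteq> {a..b} \<and> (\<Sum>k\<in>D. Sup k - Inf k) < \<delta>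
      \<longrightarrow> (\<Sum>k\<in>D. norm (f (Sup k) - f (Inf k))) < \<epsilon>"
    using assms(1)[unfolded abs_continuous_on_def, THEN spec, THEN mp, OF assms(2)]
    by (elim exE conjE)
  show ?thesis
    by (rule that[OF \<delta>(1)], rule \<delta>(2)[THEN spec, THEN mp]) (intro conjI)
qed

text \<open>Riemann sums over fine tagged divisions are compared with the increments of
  \<open>f\<close>. Tags where \<open>f\<close> is differentiable are handled by the derivative;
  intervals tagged in the exceptional null set have small total length, so absolute continuity makes
  their increments small.\<close>

theorem has_integral_abs_continuous_on:
  fixes f g :: "real \<Rightarrow> 'a::euclidean_space"
  assumes ac: "abs_continuous_on a b f" and ab: "a \<le> b"
    and der: "AE t in lebesgue_on {a..b}. (f has_vector_derivative g t) (at t within {a..b})"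
  shows "(g has_integral (f b - f a)) {a..b}"
proof -
  define N where "N = {t\<in>{a..b}. \<not> (f has_vector_derivative g t) (at t within {a..b})}"
  have N: "negligible N"
    unfolding N_def using der by (rule negligible_Collect_not_AE_lebesgue_on) simp
  \<comment> \<open>With value \<open>0\<close> on \<open>N\<close>, the Riemann terms at
    exceptional tags vanish and only the increments of \<open>f\<close> remain there.\<close>
  define g' where "g' t = (if t \<in> N then 0 else g t)" for t
  have "(g' has_integral (f b - f a)) (cbox a b)"
    unfolding has_integral
  proof (intro allI impI)
    fix e :: real assume "e > 0"
    then obtain \<delta> where "\<delta> > 0" and \<delta>: "\<And>D. D division_of \<Union>D \<Longrightarrow> \<Union>D \<subseteq> {a..b} \<Longrightarrow>
        (\<Sum>k\<in>D. Sup k - Inf k) < \<delta> \<Longrightarrow> (\<Sum>k\<in>D. norm (f (Sup k) - f (Inf k))) < e/2"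
      using abs_continuous_onE[OF ac half_gt_zero] by blast
    \<comment> \<open>An open \<open>T\<close> around \<open>N\<close> of measure below
      \<open>\<delta>\<close> will serve as the gauge at the exceptional tags.\<close>
    have "N \<in> sets lebesgue" "emeasure lebesgue N = 0"
      using N by (auto simp: negligible_iff_null_sets)
    then obtain T where T: "open T" "N \<subseteq> T" "(T - N) \<in> lmeasurable" "emeasure lebesgue (T - N) < ennreal \<delta>"
      using sets_lebesgue_outer_open \<open>\<delta> > 0\<close> by blast
    have Tm: "T \<in> lmeasurable" "measure lebesgue T < \<delta>"
    proof -
      have T': "T = (T - N) \<union> N" using T by auto
      have "N \<in> lmeasurable" using N by (simp add: negligible_imp_measurable)
      then show "T \<in> lmeasurable" using T(3) T' by (metis fmeasurable.Un)
      have "measure lebesgue (T - N) < \<delta>"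
        using T(3,4) \<open>\<delta> > 0\<close> by (simp add: emeasure_eq_measure2 ennreal_less_iff)
      moreover have "measure lebesgue T \<le> measure lebesgue (T - N) + measure lebesgue N"
        using T' T(3) \<open>N \<in> sets lebesgue\<close> by (metis fmeasurableD measure_Un_le)
      moreover have "measure lebesgue N = 0"
        using N by (simp add: negligible_imp_measure0)
      ultimately show "measure lebesgue T < \<delta>" by simp
    qed
    \<comment> \<open>The good tags contribute at most \<open>e' * (b - a)\<close>, which has to
      stay below \<open>e/2\<close>; the summand 1 covers \<open>a = b\<close>.\<close>
    define e' where "e' = e / (2 * (b - a + 1))"
    have "e' > 0" using ab \<open>e > 0\<close> by (simp add: e'_def)
    have "\<exists>d>0. \<forall>y\<in>{a..b}. norm (y - t) < d \<longrightarrow>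
            norm (f y - f t - (y - t) *\<^sub>R g t) \<le> e' * norm (y - t)" if "t \<in> {a..b} - N" for t
      using that \<open>e' > 0\<close> unfolding N_def has_vector_derivative_def has_derivative_within_alt by auto
    then obtain d where d: "\<And>t. t \<in> {a..b} - N \<Longrightarrow> d t > 0"
      "\<And>t y. t \<in> {a..b} - N \<Longrightarrow> y \<in> {a..b} \<Longrightarrow> norm (y - t) < d t \<Longrightarrow>
            norm (f y - f t - (y - t) *\<^sub>R g t) \<le> e' * norm (y - t)"
      by metis
    \<comment> \<open>Fineness puts intervals tagged in \<open>N\<close> inside \<open>T\<close> and
      the others inside the ball where the derivative estimate holds. The radius 1 is a dummy: tags
      lie in \<open>{a..b}\<close>.\<close>
    define \<gamma> where "\<gamma> t = (if t \<in> N then T else ball t (if t \<in> {a..b} then d t else 1))" for t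
    have gauge: "gauge \<gamma>"
      using d(1) T(1,2) by (auto simp: gauge_def \<gamma>_def)
    have small: "norm ((\<Sum>(x, k)\<in>\<D>. measure lborel k *\<^sub>R g' x) - (f b - f a)) < e"
      if td: "\<D> tagged_division_of (cbox a b)" and fine: "\<gamma> fine \<D>" for \<D>
    proof -
      note tdD = tagged_division_ofD[OF td]
      have kint: "\<exists>u v. k = {u..v} \<and> u \<le> x \<and> x \<le> v \<and> a \<le> u \<and> v \<le> b"
        if "(x, k) \<in> \<D>" for x k
        using tdD(2-4)[OF that] by fastforce
      have kne: "k \<noteq> {}" if "(x, k) \<in> \<D>" for x k
        using tdD(2)[OF that] by blast
      define h where "h = (\<lambda>(x, k). measure lborel k *\<^sub>R g' x - (f (Sup k) - f (Inf k)))"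
      define D1 where "D1 = {xk\<in>\<D>. fst xk \<in> N}"
      define D2 where "D2 = {xk\<in>\<D>. fst xk \<notin> N}"
      have fin: "finite \<D>" "finite D1" "finite D2" using tdD(1) by (auto simp: D1_def D2_def)
      have "(\<Sum>(x, k)\<in>\<D>. f (Sup k) - f (Inf k)) = f b - f a"
        using td ab by (intro additive_tagged_division_1) auto
      then have "(\<Sum>(x, k)\<in>\<D>. measure lborel k *\<^sub>R g' x) - (f b - f a) = sum h \<D>"
        by (simp add: h_def split_def sum_subtractf)
      also have "\<dots> = sum h D1 + sum h D2"
        using fin by (subst sum.union_disjoint[symmetric]) (auto simp: D1_def D2_def intro!: sum.cong)
      finally have eq: "(\<Sum>(x, k)\<in>\<D>. measure lborel k *\<^sub>R g' x) - (f b - f a) = sum h D1 + sum h D2" .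
      have D1p: "D1 tagged_partial_division_of cbox a b"
        by (rule tagged_partial_division_subset[of \<D>])
          (use td in \<open>simp_all add: D1_def tagged_division_of_def\<close>)
      note D1t = tagged_partial_division_of_Union_self[OF D1p]
      note D1d = division_of_tagged_division[OF D1t]
      \<comment> \<open>\<open>sum.over_tagged_division_lemma\<close> passes from tagged pairs to
        intervals, for functions that vanish on boxes with empty interior. Increments do so on
        singletons; the empty set gets the value 0 by definition.\<close>
      define V where "V k = (if k = {} then 0 else norm (f (Sup k) - f (Inf k)))" for k
      have "norm (sum h D1) \<le> (\<Sum>(x, k)\<in>D1. norm (f (Sup k) - f (Inf k)))"
        by (intro sum_norm_le) (auto simp: h_def D1_def g'_def norm_minus_commute)
      also have "\<dots> = (\<Sum>(x, k)\<in>D1. V k)"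
        by (intro sum.cong) (auto simp: V_def D1_def split: if_splits dest: kne)
      also have "\<dots> = sum V (snd ` D1)"
      proof (rule sum.over_tagged_division_lemma[OF D1t])
        fix u v :: real assume "box u v = {}"
        then show "V (cbox u v) = 0"
          by (cases "u = v") (auto simp: V_def)
      qed
      also have "\<dots> = (\<Sum>k\<in>snd ` D1. norm (f (Sup k) - f (Inf k)))"
        by (intro sum.cong) (auto simp: V_def D1_def split: if_splits dest: kne)
      also have "\<dots> < e/2"
      proof (rule \<delta>)
        show "snd ` D1 division_of \<Union> (snd ` D1)" by (rule D1d)
        show "\<Union> (snd ` D1) \<subseteq> {a..b}"
        proof
          fix y assume "y \<in> \<Union> (snd ` D1)"
          then obtain x k where "(x, k) \<in> \<D>" "y \<in> k" by (auto simp: D1_def)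
          with tdD(3)[of x k] show "y \<in> {a..b}" by auto
        qed
        have "(\<Sum>k\<in>snd ` D1. Sup k - Inf k) = sum (measure lborel) (snd ` D1)"
        proof (rule sum.cong)
          fix k assume "k \<in> snd ` D1"
          then obtain x where "(x, k) \<in> \<D>" by (auto simp: D1_def)
          then obtain u v where "k = {u..v}" "u \<le> x" "x \<le> v" using kint by blast
          then show "Sup k - Inf k = measure lborel k" by simp
        qed simp
        also have "\<dots> \<le> measure lebesgue T"
        proof (rule sum_measure_division_le[OF D1d _ Tm(1)])
          show "\<Union> (snd ` D1) \<subseteq> T"
          proof
            fix y assume "y \<in> \<Union> (snd ` D1)"
            then obtain x k where xk: "(x, k) \<in> \<D>" "x \<in> N" "y \<in> k" by (auto simp: D1_def)
            with fineD[OF fine xk(1)] show "y \<in> T" by (auto simp: \<gamma>_def)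
          qed
        qed
        also have "\<dots> < \<delta>" by (rule Tm)
        finally show "(\<Sum>k\<in>snd ` D1. Sup k - Inf k) < \<delta>" .
      qed
      finally have 1: "norm (sum h D1) < e/2" .
      have "norm (h xk) \<le> e' * measure lborel (snd xk)" if xkD: "xk \<in> D2" for xk
      proof -
        obtain x k where xk: "xk = (x, k)" "(x, k) \<in> \<D>" "x \<notin> N"
          using xkD by (cases xk) (auto simp: D2_def)
        obtain u v where k: "k = {u..v}" "u \<le> x" "x \<le> v" "a \<le> u" "v \<le> b"
          using kint[OF xk(2)] by blast
        have xab: "x \<in> {a..b}" using k by auto
        have "{u..v} \<subseteq> ball x (d x)"
          using fineD[OF fine xk(2)] xk(3) xab k(1) by (simp add: \<gamma>_def)
        moreover have "u \<in> {u..v}" "v \<in> {u..v}" using k by auto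
        ultimately have "u \<in> ball x (d x)" "v \<in> ball x (d x)" by blast+
        then have uv: "norm (u - x) < d x" "norm (v - x) < d x"
          by (simp_all add: dist_norm norm_minus_commute)
        have u: "norm (f u - f x - (u - x) *\<^sub>R g x) \<le> e' * (x - u)"
          using d(2)[of x u] uv k xk by auto
        have v: "norm (f v - f x - (v - x) *\<^sub>R g x) \<le> e' * (v - x)"
          using d(2)[of x v] uv k xk by auto
        \<comment> \<open>The increment over \<open>{u..v}\<close> is split at the tag
          \<open>x\<close>, which lies between \<open>u\<close> and \<open>v\<close>, so both halves
          fall under the derivative estimate at \<open>x\<close>.\<close>
        have "h xk = (f u - f x - (u - x) *\<^sub>R g x) - (f v - f x - (v - x) *\<^sub>R g x)"
          using k xk by (simp add: h_def g'_def algebra_simps)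
        also have "norm \<dots> \<le> e' * (x - u) + e' * (v - x)"
          by (rule order_trans[OF norm_triangle_ineq4 add_mono[OF u v]])
        finally show ?thesis using k xk by (simp add: algebra_simps)
      qed
      then have "norm (sum h D2) \<le> (\<Sum>xk\<in>D2. e' * measure lborel (snd xk))"
        by (rule sum_norm_le)
      also have "\<dots> \<le> (\<Sum>xk\<in>\<D>. e' * measure lborel (snd xk))"
        using fin \<open>e' > 0\<close> by (intro sum_mono2) (auto simp: D2_def)
      also have "\<dots> = e' * (b - a)"
        using additive_content_tagged_division[OF td] ab
        by (simp add: sum_distrib_left[symmetric] split_def)
      also have "\<dots> \<le> e/2"
        using ab \<open>e > 0\<close> by (simp add: e'_def field_simps)
      finally show ?thesis
        unfolding eq using 1 norm_triangle_ineq[of "sum h D1" "sum h D2"] by linarith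
    qed
    show "\<exists>\<gamma>. gauge \<gamma> \<and> (\<forall>\<D>. \<D> tagged_division_of cbox a b \<and> \<gamma> fine \<D> \<longrightarrow>
          norm ((\<Sum>(x, k)\<in>\<D>. measure lborel k *\<^sub>R g' x) - (f b - f a)) < e)"
    proof (intro exI conjI allI impI)
      show "gauge \<gamma>" by (rule gauge)
      show "norm ((\<Sum>(x, k)\<in>\<D>. measure lborel k *\<^sub>R g' x) - (f b - f a)) < e"
        if "\<D> tagged_division_of cbox a b \<and> \<gamma> fine \<D>" for \<D>
        by (rule small[OF conjunct1[OF that] conjunct2[OF that]])
    qed
  qed
  then have g': "(g' has_integral (f b - f a)) {a..b}" by simp
  show ?thesis
    by (rule has_integral_spike[OF N _ g']) (simp add: g'_def)
qed

text \<open>The norm of \<open>f\<close> is truncated at height \<open>n\<close>. The truncated part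
  contributes at most \<open>n\<close> times the total length, and the remainder \<open>r\<close>
  has integral below \<open>\<epsilon>/2\<close> over all of \<open>{a..b}\<close> once
  \<open>n\<close> is large, by dominated convergence.\<close>

lemma abs_continuous_on_indefinite_integral:
  fixes f :: "real \<Rightarrow> 'a::euclidean_space"
  assumes f: "f absolutely_integrable_on {a..b}"
  shows "abs_continuous_on a b (\<lambda>t. c + integral {a..t} f)"
  unfolding abs_continuous_on_def
proof (intro allI impI)
  fix \<epsilon> :: real assume "\<epsilon> > 0"
  define h where "h n x = min (norm (f x)) (real n)" for n x
  have nf: "(\<lambda>x. norm (f x)) absolutely_integrable_on {a..b}"
    using f by (simp add: absolutely_integrable_on_def)
  have h_ai: "h n absolutely_integrable_on {a..b}" for n
    unfolding h_def using nf by (intro absolutely_integrable_min_1) auto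
  have h_int: "h n integrable_on {a..b}" for n
    using h_ai set_lebesgue_integral_eq_integral(1) by blast
  have nf_int: "(\<lambda>x. norm (f x)) integrable_on {a..b}"
    using f by (simp add: absolutely_integrable_on_def)
  have "(\<lambda>n. integral {a..b} (h n)) \<longlonglongrightarrow> integral {a..b} (\<lambda>x. norm (f x))"
  proof (rule dominated_convergence(2)[OF h_int nf_int])
    show "norm (h k x) \<le> norm (f x)" for k x
      by (simp add: h_def)
    show "(\<lambda>k. h k x) \<longlonglongrightarrow> norm (f x)" for x
    proof (rule tendsto_eventually)
      obtain N where "norm (f x) \<le> real N" using real_arch_simple by blast
      then show "\<forall>\<^sub>F k in sequentially. h k x = norm (f x)"
        by (intro eventually_sequentiallyI[of N]) (simp add: h_def min_def)
    qed
  qed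
  then have "\<forall>\<^sub>F n in sequentially. dist (integral {a..b} (h n)) (integral {a..b} (\<lambda>x. norm (f x))) < \<epsilon>/2"
    using \<open>\<epsilon> > 0\<close> by (intro tendstoD) auto
  then obtain n where n: "dist (integral {a..b} (h n)) (integral {a..b} (\<lambda>x. norm (f x))) < \<epsilon>/2"
    by (auto dest: eventually_happens)
  define r where "r x = norm (f x) - h n x" for x
  have r_ai: "r absolutely_integrable_on {a..b}"
    unfolding r_def using nf h_ai by (intro set_integral_diff(1))
  have r_nonneg: "0 \<le> r x" for x by (simp add: r_def h_def)
  have r_small: "integral {a..b} r < \<epsilon>/2"
  proof -
    have "integral {a..b} r = integral {a..b} (\<lambda>x. norm (f x)) - integral {a..b} (h n)"
      unfolding r_def by (rule integral_diff[OF nf_int h_int])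
    then show ?thesis
      using n unfolding dist_real_def by linarith
  qed
  \<comment> \<open>Chosen so that \<open>n * \<delta>\<close> is at most
    \<open>\<epsilon>/2\<close>; the summand 1 covers \<open>n = 0\<close>.\<close>
  define \<delta> where "\<delta> = \<epsilon> / (2 * (real n + 1))"
  show "\<exists>\<delta>>0. \<forall>D. D division_of \<Union> D \<and> \<Union> D \<subseteq> {a..b} \<and> (\<Sum>k\<in>D. Sup k - Inf k) < \<delta> \<longrightarrow>
      (\<Sum>k\<in>D. norm (c + integral {a..Sup k} f - (c + integral {a..Inf k} f))) < \<epsilon>"
  proof (intro exI conjI allI impI)
    show "\<delta> > 0" using \<open>\<epsilon> > 0\<close> by (simp add: \<delta>_def)
    fix D assume "D division_of \<Union> D \<and> \<Union> D \<subseteq> {a..b} \<and> (\<Sum>k\<in>D. Sup k - Inf k) < \<delta>"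
    then have D: "D division_of \<Union>D" and sub: "\<Union>D \<subseteq> {a..b}" and small: "(\<Sum>k\<in>D. Sup k - Inf k) < \<delta>"
      by auto
    have term_le: "norm (c + integral {a..Sup k} f - (c + integral {a..Inf k} f))
        \<le> integral k r + real n * (Sup k - Inf k)" if "k \<in> D" for k
    proof -
      have "k \<noteq> {}" "k \<subseteq> {a..b}" using division_ofD(2,3)[OF D that] sub by auto
      obtain u v where "k = cbox u v" using division_ofD(4)[OF D \<open>k \<in> D\<close>] by (elim exE)
      with \<open>k \<noteq> {}\<close> \<open>k \<subseteq> {a..b}\<close> have k: "k = {u..v}" and uv: "u \<le> v" "a \<le> u" "v \<le> b"
        by auto
      have sv: "f absolutely_integrable_on {a..v}" "f absolutely_integrable_on k"
          "r absolutely_integrable_on k" "h n absolutely_integrable_on k"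
        using absolutely_integrable_on_subinterval[OF f] absolutely_integrable_on_subinterval[OF r_ai]
          absolutely_integrable_on_subinterval[OF h_ai] uv k by auto
      note si = sv[THEN set_lebesgue_integral_eq_integral(1)]
      have "integral {a..u} f + integral {u..v} f = integral {a..v} f"
        using uv si by (intro Henstock_Kurzweil_Integration.integral_combine) auto
      then have "norm (c + integral {a..Sup k} f - (c + integral {a..Inf k} f)) = norm (integral k f)"
        using uv k by (simp add: algebra_simps flip: \<open>integral {a..u} f + integral {u..v} f = integral {a..v} f\<close>)
      also have "\<dots> \<le> integral k (\<lambda>x. r x + h n x)"
      proof (rule integral_norm_bound_integral)
        show "(\<lambda>x. r x + h n x) integrable_on k"
          using si by (intro integrable_add)
      qed (use si in \<open>simp_all add: r_def\<close>)
      also have "\<dots> = integral k r + integral k (h n)"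
        using si by (intro integral_add) auto
      also have "integral k (h n) \<le> integral k (\<lambda>x. real n)"
        using si k by (intro integral_le) (auto simp: h_def)
      finally show ?thesis
        using uv k by (simp add: mult.commute)
    qed
    have "(\<Sum>k\<in>D. norm (c + integral {a..Sup k} f - (c + integral {a..Inf k} f)))
        \<le> (\<Sum>k\<in>D. integral k r + real n * (Sup k - Inf k))"
      by (rule sum_mono) (rule term_le)
    also have "\<dots> = (\<Sum>k\<in>D. integral k r) + real n * (\<Sum>k\<in>D. Sup k - Inf k)"
      by (simp add: sum.distrib sum_distrib_left)
    also have "(\<Sum>k\<in>D. integral k r) = integral (\<Union>D) r"
    proof -
      have "\<Union>D \<in> sets lebesgue"
        using lmeasurable_division[OF D] by (rule fmeasurableD)
      then have "r absolutely_integrable_on \<Union>D"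
        using r_ai sub by (intro set_integrable_subset[OF r_ai])
      then have "r integrable_on \<Union>D"
        by (rule set_lebesgue_integral_eq_integral(1))
      then show ?thesis
        using D by (rule integral_combine_division_topdown[symmetric])
    qed
    also have "integral (\<Union>D) r \<le> integral {a..b} r"
    proof (rule integral_subset_le[OF sub])
      have "\<Union>D \<in> sets lebesgue"
        using lmeasurable_division[OF D] by (rule fmeasurableD)
      then show "r integrable_on \<Union>D"
        using set_lebesgue_integral_eq_integral(1)[OF set_integrable_subset[OF r_ai _ sub]] by blast
      show "r integrable_on {a..b}"
        using r_ai by (rule set_lebesgue_integral_eq_integral(1))
    qed (use r_nonneg in auto)
    also have "real n * (\<Sum>k\<in>D. Sup k - Inf k) \<le> real n * \<delta>"
      using small by (intro mult_left_mono) auto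
    also have "real n * \<delta> \<le> \<epsilon> / 2"
      using \<open>\<epsilon> > 0\<close> by (simp add: \<delta>_def field_simps)
    finally show "(\<Sum>k\<in>D. norm (c + integral {a..Sup k} f - (c + integral {a..Inf k} f))) < \<epsilon>"
      using r_small by linarith
  qed
qed

text \<open>The library differentiates the integral almost everywhere from the right only; the left
  derivative comes from the reflected function.\<close>

lemma AE_has_vector_derivative_indefinite_integral:
  fixes f :: "real \<Rightarrow> 'a::euclidean_space"
  assumes f: "f integrable_on {a..b}"
  shows "AE t in lebesgue_on {a..b}.
    ((\<lambda>t. c + integral {a..t} f) has_vector_derivative f t) (at t within {a..b})"
proof -
  \<comment> \<open>Extension by zero gives integrability on every box, as
    \<open>integrable_ccontinuous_explicit\<close> requires.\<close>
  define G where "G x = (if x \<in> {a..b} then f x else 0)" for x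
  have "G integrable_on UNIV"
    unfolding G_def using f by (rule Henstock_Kurzweil_Integration.integrable_restrict_UNIV[THEN iffD2])
  then have Gint: "G integrable_on cbox x y" for x y
    by (rule integrable_on_subcbox) simp
  obtain N1 where N1: "negligible N1" "\<And>x e. \<lbrakk>x \<notin> N1; 0 < e\<rbrakk> \<Longrightarrow>
      \<exists>d>0. \<forall>h. 0 < h \<and> h < d \<longrightarrow> norm (integral (cbox x (x + h *\<^sub>R One)) G /\<^sub>R h ^ DIM(real) - G x) < e"
    using integrable_ccontinuous_explicit[of G] Gint by blast
  have "(\<lambda>x. G (- x)) integrable_on cbox x y" for x y
    using Gint[of "-y" "-x"] integrable_reflect[of G "- x" "- y"] by simp
  then obtain N2 where N2: "negligible N2" "\<And>x e. \<lbrakk>x \<notin> N2; 0 < e\<rbrakk> \<Longrightarrow>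
      \<exists>d>0. \<forall>h. 0 < h \<and> h < d \<longrightarrow> norm (integral (cbox x (x + h *\<^sub>R One)) (\<lambda>x. G (- x)) /\<^sub>R h ^ DIM(real) - G (- x)) < e"
    using integrable_ccontinuous_explicit[of "\<lambda>x. G (- x)"] by blast
  \<comment> \<open>\<open>N2\<close> is exceptional for the reflected function, which is used at
    \<open>- t\<close>; hence its mirror image is removed.\<close>
  have neg: "negligible (N1 \<union> uminus ` N2)"
    using N1(1) N2(1)
    by (intro negligible_Un negligible_differentiable_image_negligible)
      (auto intro!: derivative_intros)
  show ?thesis
  proof (rule AE_lebesgue_on_negligibleI[OF neg])
    fix t assume t: "t \<in> {a..b} - (N1 \<union> uminus ` N2)"
    then have tab: "a \<le> t" "t \<le> b" and "t \<notin> N1" and "- t \<notin> N2"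
      by (auto simp: image_iff)
    have Gt: "G t = f t" using tab by (simp add: G_def)
    have split: "integral {a..y} f - integral {a..x} f = integral {x..y} G"
      if "a \<le> x" "x \<le> y" "y \<le> b" for x y
    proof -
      have "f integrable_on {a..y}"
        using f by (rule integrable_on_subinterval) (use that in auto)
      then have "integral {a..x} f + integral {x..y} f = integral {a..y} f"
        using that by (intro Henstock_Kurzweil_Integration.integral_combine) auto
      moreover have "integral {x..y} f = integral {x..y} G"
        using that by (intro integral_cong) (auto simp: G_def)
      ultimately show ?thesis by (simp add: algebra_simps)
    qed
    \<comment> \<open>Turns a bound on a difference quotient into the first-order error bound of
      \<open>has_derivative_within_alt\<close>.\<close>
    have scale: "norm (A - h *\<^sub>R z) \<le> e * h" if "norm (A /\<^sub>R h - z) < e" "h > 0" for A z :: 'a and h e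
    proof -
      have "A - h *\<^sub>R z = h *\<^sub>R (A /\<^sub>R h - z)"
        using that by (simp add: algebra_simps)
      then have "norm (A - h *\<^sub>R z) = h * norm (A /\<^sub>R h - z)" using that by simp
      also have "\<dots> \<le> h * e" using that by (intro mult_left_mono) auto
      finally show ?thesis by (simp add: mult.commute)
    qed
    show "((\<lambda>t. c + integral {a..t} f) has_vector_derivative f t) (at t within {a..b})"
      unfolding has_vector_derivative_def has_derivative_within_alt
    proof (intro conjI allI impI)
      show "bounded_linear (\<lambda>x. x *\<^sub>R f t)" by (rule bounded_linear_scaleR_left)
      fix e :: real assume "0 < e"
      obtain d1 where d1: "d1 > 0" "\<And>h. 0 < h \<Longrightarrow> h < d1 \<Longrightarrow> norm (integral {t..t + h} G /\<^sub>R h - G t) < e"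
        using N1(2)[OF \<open>t \<notin> N1\<close> \<open>0 < e\<close>] by auto
      obtain d2 where d2: "d2 > 0" "\<And>h. 0 < h \<Longrightarrow> h < d2 \<Longrightarrow> norm (integral {-t..-t + h} (\<lambda>x. G (- x)) /\<^sub>R h - G t) < e"
        using N2(2)[OF \<open>- t \<notin> N2\<close> \<open>0 < e\<close>] by auto
      show "\<exists>d>0. \<forall>y\<in>{a..b}. norm (y - t) < d \<longrightarrow>
          norm (c + integral {a..y} f - (c + integral {a..t} f) - (y - t) *\<^sub>R f t) \<le> e * norm (y - t)"
      proof (intro exI conjI ballI impI)
        show "min d1 d2 > 0" using d1 d2 by simp
        fix y assume y: "y \<in> {a..b}" "norm (y - t) < min d1 d2"
        consider "y = t" | "y > t" | "y < t" by linarith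
        then show "norm (c + integral {a..y} f - (c + integral {a..t} f) - (y - t) *\<^sub>R f t) \<le> e * norm (y - t)"
        proof cases
          case 2
          then have "norm (integral {t..y} G /\<^sub>R (y - t) - G t) < e"
            using d1(2)[of "y - t"] y by simp
          from scale[OF this] show ?thesis
            using 2 split[of t y] tab y by (simp add: Gt)
        next
          case 3
          \<comment> \<open>Reflection turns the right difference quotient at \<open>- t\<close>
            into the left one at \<open>t\<close>.\<close>
          have "integral {-t..-y} (\<lambda>x. G (- x)) = integral {y..t} G"
            by simp
          then have "norm (integral {y..t} G /\<^sub>R (t - y) - G t) < e"
            using d2(2)[of "t - y"] y 3 by simp
          from scale[OF this] have le: "norm (integral {y..t} G - (t - y) *\<^sub>R G t) \<le> e * (t - y)"
            using 3 by simp
          have "c + integral {a..y} f - (c + integral {a..t} f) - (y - t) *\<^sub>R f t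
              = - (integral {y..t} G - (t - y) *\<^sub>R G t)"
            using split[of y t] tab y 3 by (simp add: Gt algebra_simps)
          then show ?thesis
            using le 3 by (simp only: norm_minus_cancel) simp
        qed simp
      qed
    qed
  qed simp
qed

section \<open>Continuity, restriction to subintervals and integrability of products\<close>

lemma abs_continuous_on_imp_continuous_on:
  assumes "abs_continuous_on a b f"
  shows "continuous_on {a..b} f"
  unfolding continuous_on_iff
proof (intro ballI allI impI)
  fix x e :: real assume x: "x \<in> {a..b}" and "e > 0"
  obtain \<delta> where "\<delta> > 0" and \<delta>: "\<And>D. D division_of \<Union>D \<Longrightarrow> \<Union>D \<subseteq> {a..b} \<Longrightarrow>
      (\<Sum>k\<in>D. Sup k - Inf k) < \<delta> \<Longrightarrow> (\<Sum>k\<in>D. norm (f (Sup k) - f (Inf k))) < e"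
    using abs_continuous_onE[OF assms \<open>e > 0\<close>] by blast
  have *: "norm (f v - f u) < e" if "a \<le> u" "u \<le> v" "v \<le> b" "v - u < \<delta>" for u v
  proof -
    have "{{u..v}} division_of \<Union>{{u..v}}"
      using division_of_self[of u v] that by simp
    from \<delta>[OF this] show ?thesis using that by auto
  qed
  show "\<exists>d>0. \<forall>x'\<in>{a..b}. dist x' x < d \<longrightarrow> dist (f x') (f x) < e"
  proof (intro exI conjI ballI impI)
    show "\<delta> > 0" by fact
    fix y assume "y \<in> {a..b}" "dist y x < \<delta>"
    then show "dist (f y) (f x) < e"
      using *[of x y] *[of y x] x
      by (cases "x \<le> y") (auto simp: dist_norm norm_minus_commute abs_if split: if_splits)
  qed
qed

lemma abs_continuous_on_subinterval:
  assumes "abs_continuous_on a b f" "a \<le> s" "t \<le> b"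
  shows "abs_continuous_on s t f"
  unfolding abs_continuous_on_def
proof (intro allI impI)
  fix \<epsilon> :: real assume "\<epsilon> > 0"
  obtain \<delta> where "\<delta> > 0" and \<delta>: "\<And>D. D division_of \<Union>D \<Longrightarrow> \<Union>D \<subseteq> {a..b} \<Longrightarrow>
      (\<Sum>k\<in>D. Sup k - Inf k) < \<delta> \<Longrightarrow> (\<Sum>k\<in>D. norm (f (Sup k) - f (Inf k))) < \<epsilon>"
    using abs_continuous_onE[OF assms(1) \<open>\<epsilon> > 0\<close>] by blast
  show "\<exists>\<delta>>0. \<forall>D. D division_of \<Union>D \<and> \<Union>D \<subseteq> {s..t} \<and> (\<Sum>k\<in>D. Sup k - Inf k) < \<delta>
        \<longrightarrow> (\<Sum>k\<in>D. norm (f (Sup k) - f (Inf k))) < \<epsilon>"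
  proof (intro exI[of _ \<delta>] conjI allI impI)
    fix D assume D: "D division_of \<Union>D \<and> \<Union>D \<subseteq> {s..t} \<and> (\<Sum>k\<in>D. Sup k - Inf k) < \<delta>"
    then have "\<Union>D \<subseteq> {a..b}"
      using assms(2,3) by (meson atLeastatMost_subset_iff subset_trans)
    with D show "(\<Sum>k\<in>D. norm (f (Sup k) - f (Inf k))) < \<epsilon>"
      using \<delta>[of D] by (elim conjE)
  qed fact
qed

lemma integrable_lebesgue_on_subinterval:
  fixes f :: "real \<Rightarrow> 'a::euclidean_space"
  assumes "integrable (lebesgue_on {a..b}) f" "a \<le> s" "t \<le> b"
  shows "integrable (lebesgue_on {s..t}) f"
  using assms absolutely_integrable_on_subinterval[where f=f and S="{a..b}" and a=s and b=t]
  by (simp add: integrable_lebesgue_on_iff_absolutely_integrable)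

lemma integrable_mult_continuous_on:
  fixes w g :: "real \<Rightarrow> real"
  assumes w: "integrable (lebesgue_on {a..b}) w" and g: "continuous_on {a..b} g"
  shows "integrable (lebesgue_on {a..b}) (\<lambda>t. w t * g t)"
proof -
  have "(\<lambda>t. g t * w t) absolutely_integrable_on {a..b}"
  proof (rule absolutely_integrable_bounded_measurable_product_real)
    show "g \<in> borel_measurable (lebesgue_on {a..b})"
      using g by (rule continuous_imp_measurable_on_sets_lebesgue) simp
    show "bounded (g ` {a..b})"
      using g by (intro compact_imp_bounded compact_continuous_image) auto
  qed (use w in \<open>simp_all add: integrable_lebesgue_on_iff_absolutely_integrable\<close>)
  then show ?thesis
    by (simp add: integrable_lebesgue_on_iff_absolutely_integrable mult.commute)
qed

lemma integrable_vec_nth: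
  fixes u :: "'a \<Rightarrow> real^'n"
  assumes "integrable M u"
  shows "integrable M (\<lambda>t. u t $ i)"
  using assms by (rule integrable_bounded_linear[OF bounded_linear_vec_nth])

section \<open>Horizontal curves\<close>

lemma horizontal_imp_integrable:
  "horizontal p a b \<eta> u \<Longrightarrow> integrable (lebesgue_on {a..b}) u"
  by (simp add: horizontal_def)

lemma horizontal_imp_continuous_on:
  "horizontal p a b \<eta> u \<Longrightarrow> continuous_on {a..b} (\<lambda>t. \<eta> t $ i)"
  unfolding horizontal_def
  by (rule continuous_on_component) (simp add: abs_continuous_on_imp_continuous_on)

lemma horizontal_subinterval:
  assumes "horizontal p a b \<eta> u" "a \<le> s" "t \<le> b"
  shows "horizontal p s t \<eta> u"
proof -
  have der: "AE r in lebesgue_on {a..b}.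
      (\<eta> has_vector_derivative (u r $ 1 *\<^sub>R f1 (\<eta> r) + u r $ 2 *\<^sub>R f2 p (\<eta> r))) (at r within {a..b})"
    using assms by (simp add: horizontal_def)
  have sub: "{s..t} \<subseteq> {a..b}" using assms by auto
  have "AE r in lebesgue_on {s..t}.
      (\<eta> has_vector_derivative (u r $ 1 *\<^sub>R f1 (\<eta> r) + u r $ 2 *\<^sub>R f2 p (\<eta> r))) (at r within {s..t})"
  proof (rule AE_lebesgue_on_negligibleI[OF negligible_Collect_not_AE_lebesgue_on[OF der]])
    fix r assume "r \<in> {s..t} - {r \<in> {a..b}. \<not> (\<eta> has_vector_derivative
      (u r $ 1 *\<^sub>R f1 (\<eta> r) + u r $ 2 *\<^sub>R f2 p (\<eta> r))) (at r within {a..b})}"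
    then have "(\<eta> has_vector_derivative (u r $ 1 *\<^sub>R f1 (\<eta> r) + u r $ 2 *\<^sub>R f2 p (\<eta> r))) (at r within {a..b})"
      using sub by blast
    then show "(\<eta> has_vector_derivative (u r $ 1 *\<^sub>R f1 (\<eta> r) + u r $ 2 *\<^sub>R f2 p (\<eta> r))) (at r within {s..t})"
      using sub by (rule has_vector_derivative_within_subset)
  qed simp_all
  then show ?thesis
    using assms unfolding horizontal_def
    by (blast intro: abs_continuous_on_subinterval integrable_lebesgue_on_subinterval)
qed

text \<open>The differential equation in integrated form, obtained from the fundamental theorem one
  coordinate at a time. All later estimates of horizontal curves start from these three
  integrals.\<close>

lemma horizontal_has_integral:
  assumes h: "horizontal p a b \<eta> u" and st: "a \<le> s" "s \<le> t" "t \<le> b"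
  shows "((\<lambda>r. u r $ 1) has_integral \<eta> t $ 1 - \<eta> s $ 1) {s..t}"
    and "((\<lambda>r. u r $ 2 * (1 - \<eta> r $ 1)) has_integral \<eta> t $ 2 - \<eta> s $ 2) {s..t}"
    and "((\<lambda>r. u r $ 2 * (\<eta> r $ 1) ^ p) has_integral \<eta> t $ 3 - \<eta> s $ 3) {s..t}"
proof -
  define G where "G r = u r $ 1 *\<^sub>R f1 (\<eta> r) + u r $ 2 *\<^sub>R f2 p (\<eta> r)" for r
  have "(G has_integral (\<eta> t - \<eta> s)) {s..t}"
    unfolding G_def using horizontal_subinterval[OF h st(1,3)] st(2)
    by (intro has_integral_abs_continuous_on) (auto simp: horizontal_def)
  then have "((\<lambda>r. G r $ i) has_integral (\<eta> t - \<eta> s) $ i) {s..t}" for i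
    by (rule has_integral_linear[OF _ bounded_linear_vec_nth, unfolded o_def])
  from this[of 1] this[of 2] this[of 3]
  show "((\<lambda>r. u r $ 1) has_integral \<eta> t $ 1 - \<eta> s $ 1) {s..t}"
    "((\<lambda>r. u r $ 2 * (1 - \<eta> r $ 1)) has_integral \<eta> t $ 2 - \<eta> s $ 2) {s..t}"
    "((\<lambda>r. u r $ 2 * (\<eta> r $ 1) ^ p) has_integral \<eta> t $ 3 - \<eta> s $ 3) {s..t}"
    by (simp_all add: G_def f1_def f2_def vector_3)
qed

text \<open>The system is triangular, so no fixed point is needed: \<open>x\<close> is integrated
  from \<open>u\<close> first, and then the whole velocity \<open>G\<close> is an explicit
  integrable function of time.\<close>

lemma horizontal_exists:
  assumes u: "integrable (lebesgue_on {a..b}) u"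
  obtains \<eta> where "horizontal p a b \<eta> u" "\<eta> a = q"
proof -
  define x where "x t = q $ 1 + integral {a..t} (\<lambda>r. u r $ 1)" for t
  have u1: "integrable (lebesgue_on {a..b}) (\<lambda>r. u r $ 1)"
    and u2: "integrable (lebesgue_on {a..b}) (\<lambda>r. u r $ 2)"
    using u by (auto intro: integrable_vec_nth)
  have x: "continuous_on {a..b} x"
    unfolding x_def using u1
    by (intro continuous_intros indefinite_integral_continuous_1 integrable_on_lebesgue_on) auto
  define G :: "real \<Rightarrow> real^3" where "G t = vector [u t $ 1, u t $ 2 * (1 - x t), u t $ 2 * x t ^ p]" for t
  have "integrable (lebesgue_on {a..b}) (\<lambda>t. G t $ i)" for i
  proof -
    have "i = 1 \<or> i = 2 \<or> i = 3" by (rule exhaust_3)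
    then show ?thesis
      using u1 u2 x unfolding G_def
      by (auto simp: vector_3 intro!: integrable_mult_continuous_on continuous_intros)
  qed
  then have Gi: "integrable (lebesgue_on {a..b}) G"
    by (subst integrable_iff_component) auto
  then have Ga: "G absolutely_integrable_on {a..b}"
    by (simp add: integrable_lebesgue_on_iff_absolutely_integrable)
  have GH: "G integrable_on {a..b}"
    using Gi by (intro integrable_on_lebesgue_on) auto
  define \<eta> where "\<eta> t = q + integral {a..t} G" for t
  \<comment> \<open>This closes the loop: \<open>G\<close> was built from \<open>x\<close>, and the
    curve it generates has first coordinate \<open>x\<close>, so \<open>G\<close> is the velocity
    demanded by horizontality.\<close>
  have \<eta>1: "\<eta> t $ 1 = x t" if "t \<in> {a..b}" for t
  proof -
    have "G integrable_on {a..t}"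
      using GH by (rule integrable_on_subinterval) (use that in auto)
    from integral_component_eq_cart[OF this, of 1] show ?thesis
      by (simp add: \<eta>_def x_def G_def vector_3)
  qed
  have "horizontal p a b \<eta> u"
    unfolding horizontal_def
  proof (intro conjI u)
    show "abs_continuous_on a b \<eta>"
      unfolding \<eta>_def using Ga by (rule abs_continuous_on_indefinite_integral)
    have "AE t in lebesgue_on {a..b}. (\<eta> has_vector_derivative G t) (at t within {a..b})"
      unfolding \<eta>_def using GH by (rule AE_has_vector_derivative_indefinite_integral)
    moreover have "G t = u t $ 1 *\<^sub>R f1 (\<eta> t) + u t $ 2 *\<^sub>R f2 p (\<eta> t)" if "t \<in> {a..b}" for t
      by (simp add: vec_eq_iff forall_3 G_def f1_def f2_def vector_3 \<eta>1[OF that])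
    ultimately show "AE t in lebesgue_on {a..b}.
        (\<eta> has_vector_derivative (u t $ 1 *\<^sub>R f1 (\<eta> t) + u t $ 2 *\<^sub>R f2 p (\<eta> t))) (at t within {a..b})"
      by (auto elim!: AE_mp)
  qed
  moreover have "\<eta> a = q" by (simp add: \<eta>_def)
  ultimately show thesis by (rule that)
qed

lemma L1_norm_conv_integral:
  assumes "integrable (lebesgue_on {a..b}) u"
  shows "((\<lambda>t. norm (u t)) has_integral L1_norm a b u) {a..b}"
  unfolding L1_norm_def using assms
  by (intro has_integral_integral_lebesgue_on integrable_norm) auto

section \<open>Even exponents\<close>

text \<open>As \<open>p\<close> is even and the third coordinate closes up, the length spent above height \<open>M/2\<close> is paid
  for by the excess, and the curve needs length at least \<open>M/2\<close> to climb from \<open>M/2\<close> to \<open>M\<close>.\<close>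

lemma deviation_le_excess:
  assumes h: "horizontal p c d \<zeta> v" and "c \<le> d" and "even p"
    and x0: "\<zeta> c $ 1 = 0" and z: "\<zeta> c $ 3 = \<zeta> d $ 3"
    and tm: "tm \<in> {c..d}" and M: "\<And>t. t \<in> {c..d} \<Longrightarrow> \<bar>\<zeta> t $ 1\<bar> \<le> \<bar>\<zeta> tm $ 1\<bar>"
  shows "\<bar>\<zeta> tm $ 1\<bar> \<le> 2 ^ (p + 1) * integral {c..d} (\<lambda>t. norm (v t) - v t $ 2)"
proof -
  define w where "w t = norm (v t)" for t
  define e where "e t = w t - v t $ 2" for t
  define x where "x t = \<zeta> t $ 1" for t
  define M where "M = \<bar>x tm\<bar>"
  have xM: "\<bar>x t\<bar> \<le> M" if "t \<in> {c..d}" for t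
    using M that by (simp add: x_def M_def)
  have "0 \<le> M" by (simp add: M_def)
  have x_cont: "continuous_on {c..d} x"
    unfolding x_def using h by (rule horizontal_imp_continuous_on)
  have xp_nonneg: "0 \<le> x t ^ p" for t
    using \<open>even p\<close> by (rule zero_le_even_power)
  have w_ge: "\<bar>v t $ i\<bar> \<le> w t" for t i
    unfolding w_def by (rule component_le_norm_cart)
  have e_nonneg: "0 \<le> e t" for t
    using w_ge[of t 2] by (simp add: e_def)
  note vi = horizontal_imp_integrable[OF h]
  have w_int: "integrable (lebesgue_on {c..d}) w"
    unfolding w_def using vi by (rule integrable_norm)
  have e_int: "integrable (lebesgue_on {c..d}) e"
    unfolding e_def using w_int integrable_vec_nth[OF vi]
    by (rule Bochner_Integration.integrable_diff)
  have on: "f integrable_on {c..d}" if "integrable (lebesgue_on {c..d}) f" for f :: "real \<Rightarrow> real"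
    using that by (rule integrable_on_lebesgue_on) simp
  have xp: "continuous_on {c..d} (\<lambda>t. x t ^ p)"
    using x_cont by (intro continuous_intros)
  have wx: "(\<lambda>t. w t * x t ^ p) integrable_on {c..d}" and ex: "(\<lambda>t. e t * x t ^ p) integrable_on {c..d}"
    using w_int e_int xp by (auto intro!: on integrable_mult_continuous_on)
  \<comment> \<open>As the third coordinate returns, this integral is zero; since
    \<open>w = e + v$2\<close>, the speed \<open>w\<close> and the excess \<open>e\<close> have the
    same integral against \<open>x ^ p\<close>.\<close>
  have "((\<lambda>t. v t $ 2 * x t ^ p) has_integral 0) {c..d}"
    using horizontal_has_integral(3)[OF h order_refl \<open>c \<le> d\<close> order_refl] z by (simp add: x_def)
  from has_integral_add[OF integrable_integral[OF ex] this]
  have eq: "integral {c..d} (\<lambda>t. w t * x t ^ p) = integral {c..d} (\<lambda>t. e t * x t ^ p)"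
    by (intro integral_unique) (simp add: e_def algebra_simps)
  have "integral {c..d} (\<lambda>t. e t * x t ^ p) \<le> integral {c..d} (\<lambda>t. e t * M ^ p)"
  proof (rule integral_le[OF ex])
    show "(\<lambda>t. e t * M ^ p) integrable_on {c..d}"
      using on[OF e_int] by (rule integrable_on_mult_left)
    fix t assume "t \<in> {c..d}"
    have "x t ^ p = \<bar>x t\<bar> ^ p" using \<open>even p\<close> by (simp add: power_even_abs)
    also have "\<dots> \<le> M ^ p" using xM[OF \<open>t \<in> {c..d}\<close>] by (intro power_mono) auto
    finally show "e t * x t ^ p \<le> e t * M ^ p"
      using e_nonneg by (rule mult_left_mono)
  qed
  with eq have upper: "integral {c..d} (\<lambda>t. w t * x t ^ p) \<le> M ^ p * integral {c..d} e"
    by (simp add: mult.commute)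
  have "M \<le> 2 ^ (p + 1) * integral {c..d} e"
  \<comment> \<open>The final estimate is divided by \<open>M ^ p\<close>, so \<open>M = 0\<close>
    is treated apart.\<close>
  proof (cases "M = 0")
    case True
    have "0 \<le> integral {c..d} e"
      by (intro integral_nonneg on e_int e_nonneg)
    with True show ?thesis by simp
  next
    case False
    with \<open>0 \<le> M\<close> have "M > 0" by simp
    \<comment> \<open>The last point \<open>s\<close> of \<open>S\<close> is the last time before
      \<open>tm\<close> at height \<open>M / 2\<close>. By the intermediate value theorem the curve
      stays at or above this height from \<open>s\<close> to \<open>tm\<close>, since a drop below
      it would force a later crossing.\<close>
    define S where "S = {t \<in> {c..tm}. \<bar>x t\<bar> = M / 2}"
    have ax_cont: "continuous_on {c..tm} (\<lambda>t. \<bar>x t\<bar>)"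
      using tm by (intro continuous_intros continuous_on_subset[OF x_cont]) auto
    have "compact S"
    proof -
      have "closed S"
        unfolding S_def by (intro continuous_closed_preimage_constant ax_cont) auto
      moreover have "bounded S"
        by (rule bounded_subset[OF bounded_closed_interval[of c tm]]) (auto simp: S_def)
      ultimately show ?thesis by (simp add: compact_eq_bounded_closed)
    qed
    have crossing: "\<exists>r'\<in>{r..tm}. \<bar>x r'\<bar> = M / 2" if "r \<in> {c..tm}" "\<bar>x r\<bar> \<le> M / 2" for r
    proof -
      have "\<exists>r'\<ge>r. r' \<le> tm \<and> \<bar>x r'\<bar> = M / 2"
        using that \<open>M > 0\<close>
        by (intro IVT') (auto simp: M_def intro: continuous_on_subset[OF ax_cont])
      then show ?thesis by auto
    qed
    have "S \<noteq> {}"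
      using crossing[of c] tm x0 \<open>M > 0\<close> by (force simp: S_def x_def)
    obtain s where s: "s \<in> S" "\<And>r. r \<in> S \<Longrightarrow> r \<le> s"
      using compact_attains_sup[OF \<open>compact S\<close> \<open>S \<noteq> {}\<close>] by blast
    have sI: "c \<le> s" "s \<le> tm" "\<bar>x s\<bar> = M / 2" using s by (auto simp: S_def)
    have big: "M / 2 \<le> \<bar>x r\<bar>" if r: "r \<in> {s..tm}" for r
    proof (rule ccontr)
      assume "\<not> M / 2 \<le> \<bar>x r\<bar>"
      then obtain r' where r': "r' \<in> {r..tm}" "\<bar>x r'\<bar> = M / 2"
        using crossing[of r] r sI by auto
      then have "r' \<in> S" using r sI by (auto simp: S_def)
      then have "r = s" using s(2)[of r'] r' r by auto
      with sI \<open>\<not> M / 2 \<le> \<bar>x r\<bar>\<close> show False by simp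
    qed
    have sub: "{s..tm} \<subseteq> {c..d}" using sI tm by auto
    have w_on: "w integrable_on {s..tm}"
      using on[OF w_int] sub by (rule integrable_on_subinterval)
    have x_step: "((\<lambda>r. v r $ 1) has_integral x tm - x s) {s..tm}"
      unfolding x_def using horizontal_has_integral(1)[OF h sI(1,2)] tm by simp
    have "M / 2 \<le> \<bar>x tm - x s\<bar>" using sI(3) unfolding M_def by linarith
    also have "\<bar>x tm - x s\<bar> \<le> integral {s..tm} w"
      using integral_norm_bound_integral[OF has_integral_integrable[OF x_step] w_on] w_ge
        integral_unique[OF x_step] by simp
    finally have half: "M / 2 \<le> integral {s..tm} w" .
    \<comment> \<open>On \<open>{s..tm}\<close> the length is at least \<open>M / 2\<close> and
      \<open>x ^ p\<close> at least \<open>(M / 2) ^ p\<close>. Together with \<open>upper\<close>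
      this gives \<open>(M / 2) ^ (p + 1) \<le> M ^ p * integral {c..d} e\<close>, whence the factor
      \<open>2 ^ (p + 1)\<close>.\<close>
    have "(M / 2) ^ p * (M / 2) \<le> (M / 2) ^ p * integral {s..tm} w"
      using half \<open>M > 0\<close> by (intro mult_left_mono) auto
    also have "\<dots> = integral {s..tm} (\<lambda>t. w t * (M / 2) ^ p)"
      by simp
    also have "\<dots> \<le> integral {s..tm} (\<lambda>t. w t * x t ^ p)"
    proof (rule integral_le)
      show "(\<lambda>t. w t * (M / 2) ^ p) integrable_on {s..tm}"
        using w_on by (rule integrable_on_mult_left)
      show "(\<lambda>t. w t * x t ^ p) integrable_on {s..tm}"
        using wx sub by (rule integrable_on_subinterval)
      fix t assume "t \<in> {s..tm}"
      have "(M / 2) ^ p \<le> \<bar>x t\<bar> ^ p"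
        using big[OF \<open>t \<in> {s..tm}\<close>] \<open>M > 0\<close> by (intro power_mono) auto
      also have "\<dots> = x t ^ p" using \<open>even p\<close> by (simp add: power_even_abs)
      finally show "w t * (M / 2) ^ p \<le> w t * x t ^ p"
        by (intro mult_left_mono) (auto simp: w_def)
    qed
    also have "\<dots> \<le> integral {c..d} (\<lambda>t. w t * x t ^ p)"
      using xp_nonneg
      by (intro integral_subset_le sub wx integrable_on_subinterval[OF wx sub]) (auto simp: w_def)
    also note upper
    finally have "M ^ p * M \<le> M ^ p * (2 ^ (p + 1) * integral {c..d} e)"
      by (simp add: power_divide field_simps)
    then show ?thesis
      using \<open>M > 0\<close> by (simp add: mult_le_cancel_left)
  qed
  then show ?thesis
    by (simp add: M_def x_def e_def[abs_def] w_def)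
qed

text \<open>By contradiction: a shorter competitor has length \<open>L\<close> below
  \<open>1 / 2 ^ (p + 1)\<close>. With \<open>M \<le> 2 ^ (p + 1) * C\<close> the integral of
  \<open>v$2 * x\<close>, bounded by \<open>L * M\<close>, is then at most the excess
  \<open>C\<close> in absolute value. Hence \<open>L - l\<close>, which equals \<open>C\<close> plus
  this integral, is nonnegative.\<close>

lemma horizontal_length_ge:
  assumes h: "horizontal p c d \<zeta> v" and "c \<le> d" and "even p"
    and x0: "\<zeta> c $ 1 = 0" and z: "\<zeta> c $ 3 = \<zeta> d $ 3"
    and small: "\<zeta> d $ 2 - \<zeta> c $ 2 \<le> 1 / 2 ^ (p + 1)"
  shows "\<zeta> d $ 2 - \<zeta> c $ 2 \<le> L1_norm c d v"
proof (rule ccontr)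
  define l where "l = \<zeta> d $ 2 - \<zeta> c $ 2"
  define L where "L = L1_norm c d v"
  define C where "C = integral {c..d} (\<lambda>t. norm (v t) - v t $ 2)"
  assume "\<not> \<zeta> d $ 2 - \<zeta> c $ 2 \<le> L1_norm c d v"
  then have "L < l" by (simp add: l_def L_def)
  have x_cont: "continuous_on {c..d} (\<lambda>t. \<zeta> t $ 1)"
    using h by (rule horizontal_imp_continuous_on)
  have "\<exists>tm\<in>{c..d}. \<forall>t\<in>{c..d}. \<bar>\<zeta> t $ 1\<bar> \<le> \<bar>\<zeta> tm $ 1\<bar>"
    using \<open>c \<le> d\<close> by (intro continuous_attains_sup continuous_intros x_cont) auto
  then obtain tm where tm: "tm \<in> {c..d}" "\<And>t. t \<in> {c..d} \<Longrightarrow> \<bar>\<zeta> t $ 1\<bar> \<le> \<bar>\<zeta> tm $ 1\<bar>" by blast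
  define M where "M = \<bar>\<zeta> tm $ 1\<bar>"
  have MC: "M \<le> 2 ^ (p + 1) * C"
    unfolding M_def C_def by (rule deviation_le_excess[OF h \<open>c \<le> d\<close> \<open>even p\<close> x0 z tm])
  note vi = horizontal_imp_integrable[OF h]
  note w = L1_norm_conv_integral[OF vi, folded L_def]
  have v2_int: "integrable (lebesgue_on {c..d}) (\<lambda>t. v t $ 2)"
    using vi by (rule integrable_vec_nth)
  have v2: "(\<lambda>t. v t $ 2) integrable_on {c..d}"
    using v2_int by (rule integrable_on_lebesgue_on) simp
  have v2x: "(\<lambda>t. v t $ 2 * \<zeta> t $ 1) integrable_on {c..d}"
    using integrable_mult_continuous_on[OF v2_int x_cont] by (rule integrable_on_lebesgue_on) simp
  have "((\<lambda>t. v t $ 2 * (1 - \<zeta> t $ 1)) has_integral l) {c..d}"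
    unfolding l_def using horizontal_has_integral(2)[OF h order_refl \<open>c \<le> d\<close> order_refl] .
  moreover have "((\<lambda>t. v t $ 2 * (1 - \<zeta> t $ 1)) has_integral
      integral {c..d} (\<lambda>t. v t $ 2) - integral {c..d} (\<lambda>t. v t $ 2 * \<zeta> t $ 1)) {c..d}"
    using has_integral_diff[OF integrable_integral[OF v2] integrable_integral[OF v2x]]
    by (simp add: algebra_simps)
  ultimately have l: "l = integral {c..d} (\<lambda>t. v t $ 2) - integral {c..d} (\<lambda>t. v t $ 2 * \<zeta> t $ 1)"
    by (rule has_integral_unique)
  have C: "C = L - integral {c..d} (\<lambda>t. v t $ 2)"
    unfolding C_def using has_integral_diff[OF w integrable_integral[OF v2]] by (rule integral_unique)
  have "\<bar>integral {c..d} (\<lambda>t. v t $ 2 * \<zeta> t $ 1)\<bar> \<le> integral {c..d} (\<lambda>t. norm (v t) * M)"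
  proof -
    have "norm (integral {c..d} (\<lambda>t. v t $ 2 * \<zeta> t $ 1)) \<le> integral {c..d} (\<lambda>t. norm (v t) * M)"
    proof (rule integral_norm_bound_integral[OF v2x])
      show "(\<lambda>t. norm (v t) * M) integrable_on {c..d}"
        using has_integral_integrable[OF w] by (rule integrable_on_mult_left)
      fix t assume "t \<in> {c..d}"
      then show "norm (v t $ 2 * \<zeta> t $ 1) \<le> norm (v t) * M"
        using tm component_le_norm_cart[of "v t" 2] by (auto simp: abs_mult M_def intro!: mult_mono)
    qed
    then show ?thesis by simp
  qed
  also have "\<dots> = L * M" using w by (simp add: integral_unique)
  also have "\<dots> \<le> (1 / 2 ^ (p + 1)) * (2 ^ (p + 1) * C)"
    using MC small \<open>L < l\<close>
    by (intro mult_mono) (auto simp: l_def M_def)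
  finally have "\<bar>integral {c..d} (\<lambda>t. v t $ 2 * \<zeta> t $ 1)\<bar> \<le> C" by simp
  with l C \<open>L < l\<close> show False by linarith
qed

section \<open>The line as a horizontal curve and its local minimality\<close>

lemma abs_continuous_on_gam: "abs_continuous_on a b gam"
proof -
  have "norm (gam s - gam t) = \<bar>s - t\<bar>" for s t
    by (simp add: gam_def norm_vec_def L2_set_def sum_3 vector_3)
  moreover have "\<bar>Sup k - Inf k\<bar> = Sup k - Inf k" if D: "D division_of \<Union>D" "k \<in> D" for D and k :: "real set"
  proof -
    have "k \<noteq> {}" using D by (rule division_ofD(3))
    moreover obtain u v where "k = cbox u v" using division_ofD(4)[OF D] by (elim exE)
    ultimately show ?thesis by auto
  qed
  \<comment> \<open>Since \<open>gam\<close> is isometric, both sums in the definition coincide and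
    \<open>\<delta> = \<epsilon>\<close> works.\<close>
  ultimately show ?thesis
    unfolding abs_continuous_on_def by (auto intro!: exI)
qed

text \<open>The control is prescribed only almost everywhere so that representatives of a class of
  controls are covered. Along the line \<open>f2\<close> is the constant second basis vector because
  \<open>0 ^ p = 0\<close>.\<close>

lemma horizontal_gam:
  assumes "integrable (lebesgue_on {a..b}) u" "AE t in lebesgue_on {a..b}. u t = vector [0, 1]" "p \<ge> 1"
  shows "horizontal p a b gam u"
  unfolding horizontal_def
proof (intro conjI assms(1) abs_continuous_on_gam)
  have der: "(gam has_vector_derivative f2 p (gam t)) (at t within {a..b})" for t
  proof -
    have gam: "gam = (\<lambda>t. t *\<^sub>R axis 2 1)"
      by (auto simp: gam_def fun_eq_iff vec_eq_iff forall_3 vector_3 axis_def)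
    have f2: "f2 p (gam t) = axis 2 1"
      using \<open>p \<ge> 1\<close> by (auto simp: f2_def gam_def vec_eq_iff forall_3 vector_3 axis_def)
    show ?thesis
      unfolding f2 unfolding gam has_vector_derivative_def
      by (rule bounded_linear_imp_has_derivative[OF bounded_linear_scaleR_left])
  qed
  show "AE t in lebesgue_on {a..b}.
      (gam has_vector_derivative (u t $ 1 *\<^sub>R f1 (gam t) + u t $ 2 *\<^sub>R f2 p (gam t))) (at t within {a..b})"
    using assms(2) der by (auto elim!: AE_mp)
qed

lemma length_minimizing_gam:
  assumes "even p" "p \<ge> 1" "a \<le> b" "b - a \<le> 1 / 2 ^ (p + 1)"
  shows "length_minimizing p a b gam"
  unfolding length_minimizing_def
proof (intro exI conjI allI impI)
  show "horizontal p a b gam (\<lambda>_. vector [0, 1])"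
    using \<open>p \<ge> 1\<close> by (intro horizontal_gam) auto
  fix c d \<zeta> v
  assume *: "c \<le> d \<and> horizontal p c d \<zeta> v \<and> \<zeta> c = gam a \<and> \<zeta> d = gam b"
  have "L1_norm a b (\<lambda>_. vector [0, 1]) = b - a"
    using \<open>a \<le> b\<close> by (simp add: L1_norm_def norm_vec_def L2_set_def sum_2 vector_2 measure_restrict_space)
  also have "\<dots> = \<zeta> d $ 2 - \<zeta> c $ 2"
    using * by (simp add: gam_def vector_3)
  also have "\<dots> \<le> L1_norm c d v"
    using * assms by (intro horizontal_length_ge) (auto simp: gam_def vector_3)
  finally show "L1_norm a b (\<lambda>_. vector [0, 1]) \<le> L1_norm c d v" .
qed

theorem locally_length_minimizing_gam:
  assumes "even p" "p \<ge> 1"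
  shows "locally_length_minimizing p {0..1} gam"
  unfolding locally_length_minimizing_def
proof
  fix t :: real assume t: "t \<in> {0..1}"
  \<comment> \<open>Half of the admissible length \<open>1 / 2 ^ (p + 1)\<close>, since subintervals
    of a ball of radius \<open>r\<close> have length at most \<open>2 * r\<close>.\<close>
  define r :: real where "r = 1 / 2 ^ (p + 2)"
  have "r > 0" by (simp add: r_def)
  show "\<exists>N. openin (top_of_set {0..1}) N \<and> t \<in> N \<and>
      (\<forall>a b. a \<le> b \<and> {a..b} \<subseteq> N \<longrightarrow> length_minimizing p a b gam)"
  proof (intro exI conjI allI impI)
    show "openin (top_of_set {0..1}) ({0..1} \<inter> ball t r)" by (rule openin_open_Int) simp
    show "t \<in> {0..1} \<inter> ball t r" using t \<open>r > 0\<close> by simp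
    fix a b assume ab: "a \<le> b \<and> {a..b} \<subseteq> {0..1} \<inter> ball t r"
    then have "a \<in> ball t r" "b \<in> ball t r" by auto
    then have "b - a \<le> 2 * r" by (simp add: dist_real_def)
    also have "2 * r = 1 / 2 ^ (p + 1)" by (simp add: r_def)
    finally show "length_minimizing p a b gam"
      using ab assms by (intro length_minimizing_gam) auto
  qed
qed

section \<open>The exponent three\<close>

text \<open>The integral of the cube is \<open>32/1155 m\<^sup>2 - 736/2145\<close>, whence the value of \<open>m\<close>.\<close>

lemma integral_cubed_profile:
  fixes m :: real
  assumes m: "m\<^sup>2 = 161 / 13"
  shows "((\<lambda>y. ((1 - y\<^sup>2) * (4 * y\<^sup>2 - 1 + m * y)) ^ 3) has_integral 0) {-1..1}"
proof -
  \<comment> \<open>The antiderivative of the expanded cube, grouped by powers of \<open>m\<close>.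
    The groups of \<open>m\<close> and \<open>m^3\<close> are even in \<open>y\<close> and cancel
    between -1 and 1, so only the constant and \<open>m^2\<close> parts enter the condition on
    \<open>m\<close>.\<close>
  define F where "F y = - y + 5 * y^3 - 87/5 * y^5 + 35 * y^7 - 116/3 * y^9 + 240/11 * y^11 - 64/13 * y^13
    + m * (3/2 * y^2 - 33/4 * y^4 + 43/2 * y^6 - 219/8 * y^8 + 84/5 * y^10 - 4 * y^12)
    + m^2 * (-(y^3) + 21/5 * y^5 - 45/7 * y^7 + 13/3 * y^9 - 12/11 * y^11)
    + m^3 * (1/4 * y^4 - 1/2 * y^6 + 3/8 * y^8 - 1/10 * y^10)" for y :: real
  have "((\<lambda>y. ((1 - y\<^sup>2) * (4 * y\<^sup>2 - 1 + m * y)) ^ 3) has_integral F 1 - F (-1)) {-1..1}"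
  proof (rule fundamental_theorem_of_calculus)
    fix y :: real
    have "(F has_real_derivative - 1 + 15 * y^2 - 87 * y^4 + 245 * y^6 - 348 * y^8 + 240 * y^10 - 64 * y^12
      + m * (3 * y - 33 * y^3 + 129 * y^5 - 219 * y^7 + 168 * y^9 - 48 * y^11)
      + m^2 * (- 3 * y^2 + 21 * y^4 - 45 * y^6 + 39 * y^8 - 12 * y^10)
      + m^3 * (y^3 - 3 * y^5 + 3 * y^7 - y^9)) (at y within {-1..1})"
      unfolding F_def by (auto intro!: derivative_eq_intros simp: algebra_simps)
    also have "- 1 + 15 * y^2 - 87 * y^4 + 245 * y^6 - 348 * y^8 + 240 * y^10 - 64 * y^12
      + m * (3 * y - 33 * y^3 + 129 * y^5 - 219 * y^7 + 168 * y^9 - 48 * y^11)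
      + m^2 * (- 3 * y^2 + 21 * y^4 - 45 * y^6 + 39 * y^8 - 12 * y^10)
      + m^3 * (y^3 - 3 * y^5 + 3 * y^7 - y^9) = ((1 - y\<^sup>2) * (4 * y\<^sup>2 - 1 + m * y)) ^ 3"
      by algebra
    finally show "(F has_vector_derivative ((1 - y\<^sup>2) * (4 * y\<^sup>2 - 1 + m * y)) ^ 3) (at y within {-1..1})"
      by (simp add: has_real_derivative_iff_has_vector_derivative)
  qed simp
  moreover have "F 1 - F (-1) = 0"
    by (simp add: F_def m)
  ultimately show ?thesis by simp
qed

text \<open>The competitor keeps the second control at \<open>\<tau>\<close> and has first
  coordinate \<open>\<delta> * \<phi>\<close>. It reaches height \<open>b\<close>, beyond
  \<open>2 * \<tau>\<close> by \<open>4/15 * \<tau> * \<delta>\<close>, while its length exceeds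
  \<open>2 * \<tau>\<close> by less than that.\<close>

lemma shorter_competitor:
  fixes \<tau> :: real
  assumes \<tau>: "0 < \<tau>" "\<tau> \<le> 1"
  obtains b \<zeta> v where "0 < b" "b \<le> 3 * \<tau>" "horizontal 3 (-1) 1 \<zeta> v"
    "\<zeta> (-1) = gam 0" "\<zeta> 1 = gam b" "L1_norm (-1) 1 v < b"
proof -
  define m :: real where "m = sqrt (161 / 13)"
  have m2: "m\<^sup>2 = 161 / 13" by (simp add: m_def)
  have m: "0 \<le> m" "m \<le> 4" unfolding m_def by (auto intro: real_le_lsqrt)
  \<comment> \<open>With this choice the excess bound
    \<open>\<delta>\<^sup>2 * 42\<^sup>2 / \<tau>\<close> equals
    \<open>0.1764 * \<tau> * \<delta>\<close>, below the gain
    \<open>4/15 * \<tau> * \<delta>\<close>.\<close>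
  define \<delta> where "\<delta> = \<tau>\<^sup>2 / 10000"
  have "\<delta> > 0" using \<tau> by (simp add: \<delta>_def)
  \<comment> \<open>The integral of \<open>\<tau> * (1 - \<delta> * \<phi>)\<close> over
    \<open>{-1..1}\<close>, the integral of \<open>\<phi>\<close> being -4/15.\<close>
  define b where "b = 2 * \<tau> + 4 / 15 * \<tau> * \<delta>"
  \<comment> \<open>The factor \<open>1 - y\<^sup>2\<close> makes both ends return to the line. The
    part with \<open>m * y\<close> is odd and does not change the integral of \<open>\<phi>\<close>,
    but it raises the integral of the cube from a negative value to 0.\<close>
  define \<phi> where "\<phi> y = (1 - y\<^sup>2) * (4 * y\<^sup>2 - 1 + m * y)" for y
  define \<phi>' where "\<phi>' y = 10 * y - 16 * y ^ 3 + m - 3 * m * y\<^sup>2" for y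
  have \<phi>_der: "(\<phi> has_vector_derivative \<phi>' y) (at y within S)" for y S
    unfolding has_real_derivative_iff_has_vector_derivative[symmetric] \<phi>_def \<phi>'_def
    by (auto intro!: derivative_eq_intros simp: algebra_simps power2_eq_square power3_eq_cube)
  have ends: "\<phi> (-1) = 0" "\<phi> 1 = 0" by (simp_all add: \<phi>_def)
  have \<phi>_int: "(\<phi> has_integral - 4 / 15) {-1..1}"
  proof -
    define F where "F y = 5/3 * y^3 - 4/5 * y^5 - y + m * (1/2 * y^2 - 1/4 * y^4)" for y :: real
    have "(\<phi> has_integral F 1 - F (-1)) {-1..1}"
    proof (rule fundamental_theorem_of_calculus)
      show "(F has_vector_derivative \<phi> y) (at y within {-1..1})" for y
        unfolding has_real_derivative_iff_has_vector_derivative[symmetric] \<phi>_def F_def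
        by (auto intro!: derivative_eq_intros simp: algebra_simps power2_eq_square power3_eq_cube power4_eq_xxxx)
    qed simp
    then show ?thesis by (simp add: F_def)
  qed
  define u :: "real \<Rightarrow> real^2" where "u y = vector [\<delta> * \<phi>' y, \<tau>]" for y
  have \<phi>'_cont: "continuous_on {-1..1} \<phi>'"
    unfolding \<phi>'_def by (intro continuous_intros)
  have u_int: "integrable (lebesgue_on {-1..1}) u"
  proof -
    have "integrable (lebesgue_on {-1..1}) (\<lambda>y. \<delta> * \<phi>' y)"
      using \<phi>'_cont by (intro continuous_imp_integrable_real continuous_intros)
    then have "integrable (lebesgue_on {-1..1}) (\<lambda>y. u y $ i)" for i
      using exhaust_2[of i] by (auto simp: u_def vector_2)
    then show ?thesis by (subst integrable_iff_component) auto
  qed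
  obtain \<zeta> where h: "horizontal 3 (-1) 1 \<zeta> u" and start: "\<zeta> (-1) = gam 0"
    using horizontal_exists[OF u_int, of 3 "gam 0"] by blast
  have x: "\<zeta> y $ 1 = \<delta> * \<phi> y" if y: "y \<in> {-1..1}" for y
  proof -
    have "((\<lambda>y. \<delta> * \<phi>' y) has_integral \<delta> * \<phi> y - \<delta> * \<phi> (-1)) {-1..y}"
      using y by (intro fundamental_theorem_of_calculus has_vector_derivative_mult_right \<phi>_der) auto
    moreover have "((\<lambda>y. \<delta> * \<phi>' y) has_integral \<zeta> y $ 1) {-1..y}"
      using horizontal_has_integral(1)[OF h, of "-1" y] y start by (simp add: u_def vector_2 vector_3 gam_def)
    ultimately show ?thesis
      using ends by (metis diff_zero has_integral_unique mult_zero_right)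
  qed
  have "\<zeta> 1 $ 2 = b"
  proof (rule has_integral_unique)
    show "((\<lambda>y. u y $ 2 * (1 - \<zeta> y $ 1)) has_integral \<zeta> 1 $ 2) {-1..1}"
      using horizontal_has_integral(2)[OF h, of "-1" 1] start by (simp add: gam_def vector_3)
    have "((\<lambda>y. \<tau> - \<tau> * \<delta> * \<phi> y) has_integral b) {-1..1}"
      using has_integral_diff[OF has_integral_const_real[of \<tau> "-1" 1] has_integral_mult_right[OF \<phi>_int, of "\<tau> * \<delta>"]]
      by (simp add: b_def mult_ac)
    then show "((\<lambda>y. u y $ 2 * (1 - \<zeta> y $ 1)) has_integral b) {-1..1}"
      by (rule has_integral_eq[rotated]) (simp add: u_def vector_2 x algebra_simps)
  qed
  moreover have "\<zeta> 1 $ 3 = 0"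
  proof (rule has_integral_unique)
    show "((\<lambda>y. u y $ 2 * (\<zeta> y $ 1) ^ 3) has_integral \<zeta> 1 $ 3) {-1..1}"
      using horizontal_has_integral(3)[OF h, of "-1" 1] start by (simp add: gam_def vector_3)
    have "((\<lambda>y. \<tau> * \<delta> ^ 3 * \<phi> y ^ 3) has_integral 0) {-1..1}"
      using has_integral_mult_right[OF integral_cubed_profile[OF m2], of "\<tau> * \<delta> ^ 3"]
      by (simp add: \<phi>_def)
    then show "((\<lambda>y. u y $ 2 * (\<zeta> y $ 1) ^ 3) has_integral 0) {-1..1}"
      by (rule has_integral_eq[rotated]) (simp add: u_def vector_2 x power_mult_distrib)
  qed
  moreover have "\<zeta> 1 $ 1 = 0" using x[of 1] ends by simp
  ultimately have finish: "\<zeta> 1 = gam b"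
    by (simp add: vec_eq_iff forall_3 gam_def vector_3)
  have "norm (u y) \<le> \<tau> + \<delta>\<^sup>2 * 42\<^sup>2 / (2 * \<tau>)" if y: "y \<in> {-1..1}" for y
  proof -
    have "\<bar>y\<bar> \<le> 1" using y by auto
    then have "\<bar>y ^ 3\<bar> \<le> 1" "y\<^sup>2 \<le> 1" by (auto simp: power_abs power_le_one abs_square_le_1)
    \<comment> \<open>The bound 42 has slack: \<open>10 + 16 + 2 * m\<close> is at most 34.\<close>
    have "\<bar>m - 3 * m * y\<^sup>2\<bar> \<le> 2 * m"
    proof -
      have "0 \<le> m * y\<^sup>2" "m * y\<^sup>2 \<le> m" using m \<open>y\<^sup>2 \<le> 1\<close> by (simp_all add: mult_left_le)
      then show ?thesis by (auto simp: abs_le_iff)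
    qed
    with m \<open>\<bar>y\<bar> \<le> 1\<close> \<open>\<bar>y ^ 3\<bar> \<le> 1\<close> have "\<bar>\<phi>' y\<bar> \<le> 42" unfolding \<phi>'_def by linarith
    then have sq: "(\<phi>' y)\<^sup>2 \<le> 42\<^sup>2" using abs_le_square_iff[of "\<phi>' y" 42] by simp
    have "norm (u y) = sqrt ((\<delta> * \<phi>' y)\<^sup>2 + \<tau>\<^sup>2)"
      by (simp add: u_def norm_vec_def L2_set_def sum_2 vector_2)
    \<comment> \<open>The bound \<open>sqrt (\<tau>\<^sup>2 + s\<^sup>2) \<le> \<tau> + s\<^sup>2 /
      (2 * \<tau>)\<close>, checked by squaring: the excess of the speed is quadratic in
      \<open>\<delta>\<close>.\<close>
    also have "\<dots> \<le> \<tau> + \<delta>\<^sup>2 * 42\<^sup>2 / (2 * \<tau>)"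
    proof (rule real_le_lsqrt)
      have "(\<delta> * \<phi>' y)\<^sup>2 + \<tau>\<^sup>2 \<le> \<delta>\<^sup>2 * 42\<^sup>2 + \<tau>\<^sup>2"
        unfolding power_mult_distrib using sq by (intro add_mono mult_left_mono) auto
      also have "\<dots> \<le> (\<tau> + \<delta>\<^sup>2 * 42\<^sup>2 / (2 * \<tau>))\<^sup>2"
        using \<tau> by (simp add: power2_sum)
      finally show "(\<delta> * \<phi>' y)\<^sup>2 + \<tau>\<^sup>2 \<le> (\<tau> + \<delta>\<^sup>2 * 42\<^sup>2 / (2 * \<tau>))\<^sup>2" .
    qed (use \<tau> in simp)
    finally show ?thesis .
  qed
  then have "L1_norm (-1) 1 u \<le> (\<tau> + \<delta>\<^sup>2 * 42\<^sup>2 / (2 * \<tau>)) * 2"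
    using has_integral_le[OF L1_norm_conv_integral[OF u_int] has_integral_const_real[of "\<tau> + \<delta>\<^sup>2 * 42\<^sup>2 / (2 * \<tau>)" "-1" 1]]
    by (simp add: mult.commute)
  also have "\<dots> = 2 * \<tau> + (42\<^sup>2 / 10000) * \<tau> * \<delta>"
    using \<tau> by (simp add: \<delta>_def power2_eq_square)
  also have "\<dots> < b"
    using \<tau> \<open>\<delta> > 0\<close> by (simp add: b_def)
  finally have "L1_norm (-1) 1 u < b" .
  moreover have "b \<le> 3 * \<tau>"
  proof -
    have "\<delta> \<le> 1" using \<tau> power_le_one[of \<tau> 2] by (simp add: \<delta>_def)
    then have "\<tau> * \<delta> \<le> \<tau>" using \<tau> by (simp add: mult_left_le)
    then show ?thesis using \<tau> by (simp add: b_def)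
  qed
  moreover have "0 < b" using \<tau> \<open>\<delta> > 0\<close> by (simp add: b_def add_pos_pos)
  ultimately show thesis using that h start finish by blast
qed

text \<open>Shorter competitors exist at every small scale, so they defeat any neighborhood of time
  0.\<close>

theorem not_locally_length_minimizing_gam: "\<not> locally_length_minimizing 3 {0..1} gam"
proof
  assume "locally_length_minimizing 3 {0..1} gam"
  then obtain N where N: "openin (top_of_set {0..1}) N" "0 \<in> N"
    and min: "\<And>a b. a \<le> b \<Longrightarrow> {a..b} \<subseteq> N \<Longrightarrow> length_minimizing 3 a b gam"
    unfolding locally_length_minimizing_def by (meson atLeastAtMost_iff order_refl zero_le_one)
  then obtain e where e: "e > 0" "ball 0 e \<inter> {0..1} \<subseteq> N"
    unfolding openin_contains_ball by blast
  define \<tau> where "\<tau> = min e 1 / 4"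
  have \<tau>: "0 < \<tau>" "\<tau> \<le> 1" "3 * \<tau> < e" "3 * \<tau> \<le> 1" using e by (auto simp: \<tau>_def min_def)
  obtain b \<zeta> v where b: "0 < b" "b \<le> 3 * \<tau>" and comp: "horizontal 3 (-1) 1 \<zeta> v"
    "\<zeta> (-1) = gam 0" "\<zeta> 1 = gam b" "L1_norm (-1) 1 v < b"
    using shorter_competitor[OF \<tau>(1,2)] by blast
  have "{0..b} \<subseteq> ball 0 e \<inter> {0..1}" using b \<tau> by (auto simp: dist_real_def)
  with e(2) have "{0..b} \<subseteq> N" by (rule order_trans[rotated])
  with min[of 0 b] b have "length_minimizing 3 0 b gam" by simp
  then obtain u where u: "horizontal 3 0 b gam u"
    and le: "\<And>c d \<zeta> v. c \<le> d \<and> horizontal 3 c d \<zeta> v \<and> \<zeta> c = gam 0 \<and> \<zeta> d = gam b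
           \<Longrightarrow> L1_norm 0 b u \<le> L1_norm c d v"
    unfolding length_minimizing_def by blast
  \<comment> \<open>Minimality provides some unspecified control \<open>u\<close> of the line. As
    \<open>1 - x\<close> is 1 along it, the second component of \<open>u\<close> integrates to
    \<open>b\<close>, so the length is at least \<open>b\<close>.\<close>
  have "((\<lambda>r. u r $ 2) has_integral b) {0..b}"
    using horizontal_has_integral(2)[OF u, of 0 b] b by (simp add: gam_def vector_3)
  from has_integral_le[OF this L1_norm_conv_integral[OF horizontal_imp_integrable[OF u]]]
  have "b \<le> L1_norm 0 b u"
    using component_le_norm_cart[of "u _" 2] by (meson abs_le_D1)
  also have "\<dots> \<le> L1_norm (-1) 1 v" using comp by (intro le) auto
  finally show False using comp(4) by simp
qed

section \<open>The end-point map near the control of the line\<close>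

lemma abs_rep_control: "abs_control (rep_control w) = w"
  by (rule Quotient3_abs_rep[OF Quotient3_control])

lemma integrable_rep_control: "integrable (lebesgue_on {0..1}) (rep_control w)"
  using Quotient3_rep_reflp[OF Quotient3_control, of w] by (simp add: L1_eq_def)

lemma rep_abs_control_AE:
  assumes "integrable (lebesgue_on {0..1}) f"
  shows "AE t in lebesgue_on {0..1}. rep_control (abs_control f) t = f t"
  using Quotient3_rep_abs[OF Quotient3_control, of f] assms by (simp add: L1_eq_def)

lemma rep_control_add_AE:
  "AE t in lebesgue_on {0..1}. rep_control (v + w) t = rep_control v t + rep_control w t"
proof -
  have "v + w = abs_control (\<lambda>t. rep_control v t + rep_control w t)"
    using plus_control.abs_eq[of "rep_control v" "rep_control w"]
      Quotient3_rep_reflp[OF Quotient3_control] by (simp add: abs_rep_control)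
  then show ?thesis
    by (simp add: rep_abs_control_AE integrable_rep_control)
qed

lemma rep_control_scaleR_AE:
  "AE t in lebesgue_on {0..1}. rep_control (r *\<^sub>R w) t = r *\<^sub>R rep_control w t"
proof -
  have "r *\<^sub>R w = abs_control (\<lambda>t. r *\<^sub>R rep_control w t)"
    using scaleR_control.abs_eq[of "rep_control w" r]
      Quotient3_rep_reflp[OF Quotient3_control] by (simp add: abs_rep_control)
  then show ?thesis
    by (simp add: rep_abs_control_AE integrable_rep_control)
qed

lemma norm_abs_control:
  assumes "integrable (lebesgue_on {0..1}) f"
  shows "norm (abs_control f) = L1_norm 0 1 f"
  using assms by (intro norm_control.abs_eq) (simp add: L1_eq_def)

lemma norm_control_has_integral: "((\<lambda>t. norm (rep_control w t)) has_integral norm w) {0..1}"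
proof -
  have "norm w = L1_norm 0 1 (rep_control w)"
    using norm_abs_control[OF integrable_rep_control, of w] by (simp add: abs_rep_control)
  then show ?thesis
    using L1_norm_conv_integral[OF integrable_rep_control] by simp
qed

section \<open>Integrals of a control and the first coordinate of its curve\<close>

lemma rep_control_nth_integrable_on:
  assumes "0 \<le> s" "t \<le> 1"
  shows "(\<lambda>r. rep_control w r $ i) integrable_on {s..t}"
  by (intro integrable_on_lebesgue_on integrable_vec_nth
      integrable_lebesgue_on_subinterval[OF integrable_rep_control assms]) simp

lemma integral_AE_cong:
  fixes f g :: "real \<Rightarrow> 'a::euclidean_space"
  assumes "AE t in lebesgue_on {a..b}. f t = g t" "a \<le> s" "t \<le> b"
  shows "integral {s..t} f = integral {s..t} g"
  using negligible_Collect_not_AE_lebesgue_on[OF assms(1)]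
  by (rule integral_spike) (use assms in auto)

text \<open>The first coordinate of the horizontal curve from the origin with control
  \<open>w\<close>. It is linear in \<open>w\<close>, and all nonlinearity of the end-point map
  comes from products with it and its powers.\<close>

definition control_x1 :: "control \<Rightarrow> real \<Rightarrow> real" where
  "control_x1 w t = integral {0..t} (\<lambda>s. rep_control w s $ 1)"

lemma control_x1_add:
  assumes "t \<le> 1"
  shows "control_x1 (v + w) t = control_x1 v t + control_x1 w t"
proof -
  have "integral {0..t} (\<lambda>s. rep_control (v + w) s $ 1)
      = integral {0..t} (\<lambda>s. rep_control v s $ 1 + rep_control w s $ 1)"
    using rep_control_add_AE[of v w] assms
    by (intro integral_AE_cong[where a = 0 and b = 1]) (auto elim!: AE_mp)
  then show ?thesis
    using assms by (simp add: control_x1_def integral_add rep_control_nth_integrable_on)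
qed

lemma control_x1_scaleR:
  assumes "t \<le> 1"
  shows "control_x1 (r *\<^sub>R w) t = r * control_x1 w t"
proof -
  have "integral {0..t} (\<lambda>s. rep_control (r *\<^sub>R w) s $ 1) = integral {0..t} (\<lambda>s. r * rep_control w s $ 1)"
    using rep_control_scaleR_AE[of r w] assms
    by (intro integral_AE_cong[where a = 0 and b = 1]) (auto elim!: AE_mp)
  then show ?thesis
    by (simp add: control_x1_def)
qed

lemma continuous_on_control_x1: "continuous_on {0..1} (control_x1 w)"
  unfolding control_x1_def
  by (intro indefinite_integral_continuous_1 rep_control_nth_integrable_on) auto

lemma abs_control_x1_le:
  assumes "t \<le> 1"
  shows "\<bar>control_x1 w t\<bar> \<le> norm w"
proof -
  note n = norm_control_has_integral[of w]
  have "norm (control_x1 w t) \<le> integral {0..t} (\<lambda>s. norm (rep_control w s))"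
    unfolding control_x1_def using assms
    by (intro integral_norm_bound_integral rep_control_nth_integrable_on
        integrable_on_subinterval[OF has_integral_integrable[OF n]])
      (auto intro: component_le_norm_cart)
  also have "\<dots> \<le> integral {0..1} (\<lambda>s. norm (rep_control w s))"
    using assms
    by (intro integral_subset_le has_integral_integrable[OF n]
        integrable_on_subinterval[OF has_integral_integrable[OF n]]) auto
  also have "\<dots> = norm w" using n by (rule integral_unique)
  finally show ?thesis by simp
qed

lemma rep_control_mult_integrable_on:
  assumes "continuous_on {0..1} g"
  shows "(\<lambda>t. rep_control w t $ i * g t) integrable_on {0..1}"
  by (intro integrable_on_lebesgue_on integrable_mult_continuous_on integrable_vec_nth
      integrable_rep_control assms) simp

lemma abs_integral_rep_control_mult_le:
  assumes g: "continuous_on {0..1} g" and B: "\<And>t. t \<in> {0..1} \<Longrightarrow> \<bar>g t\<bar> \<le> B"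
  shows "\<bar>integral {0..1} (\<lambda>t. rep_control w t $ i * g t)\<bar> \<le> norm w * B"
proof -
  note n = has_integral_mult_left[OF norm_control_has_integral[of w], of B]
  have "norm (integral {0..1} (\<lambda>t. rep_control w t $ i * g t))
      \<le> integral {0..1} (\<lambda>t. norm (rep_control w t) * B)"
  proof (rule integral_norm_bound_integral[OF rep_control_mult_integrable_on[OF g] has_integral_integrable[OF n]])
    show "norm (rep_control w t $ i * g t) \<le> norm (rep_control w t) * B" if "t \<in> {0..1}" for t
      using B[OF that] component_le_norm_cart[of "rep_control w t" i]
      by (auto simp: abs_mult intro!: mult_mono)
  qed
  then show ?thesis unfolding integral_unique[OF n] by simp
qed

text \<open>The integrated equations fix the end-point of every admissible curve, and such a curve
  exists; so the description in \<open>endpoint_map\<close> is well defined and can be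
  evaluated.\<close>

lemma endpoint_map_gam_0:
  "endpoint_map p (gam 0) w = vector [control_x1 w 1,
    integral {0..1} (\<lambda>t. rep_control w t $ 2 * (1 - control_x1 w t)),
    integral {0..1} (\<lambda>t. rep_control w t $ 2 * control_x1 w t ^ p)]" (is "_ = ?q")
proof -
  have endpt: "\<eta> 1 = ?q" if h: "horizontal p 0 1 \<eta> (rep_control w)" and 0: "\<eta> 0 = gam 0" for \<eta>
  proof -
    have x: "control_x1 w t = \<eta> t $ 1" if "t \<in> {0..1}" for t
      using horizontal_has_integral(1)[OF h, of 0 t] that 0
      by (simp add: control_x1_def integral_unique gam_def vector_3)
    have "integral {0..1} (\<lambda>t. rep_control w t $ 2 * (1 - control_x1 w t)) = \<eta> 1 $ 2"
      using horizontal_has_integral(2)[OF h, of 0 1] 0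
      by (subst integral_cong[where g = "\<lambda>t. rep_control w t $ 2 * (1 - \<eta> t $ 1)"])
        (simp_all add: x integral_unique gam_def vector_3)
    moreover have "integral {0..1} (\<lambda>t. rep_control w t $ 2 * control_x1 w t ^ p) = \<eta> 1 $ 3"
      using horizontal_has_integral(3)[OF h, of 0 1] 0
      by (subst integral_cong[where g = "\<lambda>t. rep_control w t $ 2 * (\<eta> t $ 1) ^ p"])
        (simp_all add: x integral_unique gam_def vector_3)
    ultimately show ?thesis
      using x[of 1] by (simp add: vec_eq_iff forall_3 vector_3)
  qed
  obtain \<eta> where \<eta>: "horizontal p 0 1 \<eta> (rep_control w)" "\<eta> 0 = gam 0"
    using horizontal_exists[OF integrable_rep_control] .
  show ?thesis
    unfolding endpoint_map_def
  proof (rule the_equality)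
    show "\<exists>\<eta>. horizontal p 0 1 \<eta> (rep_control w) \<and> \<eta> 0 = gam 0 \<and> \<eta> 1 = ?q"
      using \<eta> endpt by blast
  qed (use endpt in blast)
qed

section \<open>Differentiability of the end-point map at the line\<close>

definition line_control :: control where
  "line_control = abs_control (\<lambda>_. vector [0, 1])"

text \<open>The part linear in \<open>v\<close> of the end-point for
  \<open>line_control + v\<close>. The third entry is 0 because \<open>x ^ p\<close> is at least
  quadratic in \<open>v\<close> when \<open>p \<ge> 2\<close>.\<close>

definition endpoint_deriv :: "control \<Rightarrow> real^3" where
  "endpoint_deriv v = vector [control_x1 v 1,
    integral {0..1} (\<lambda>t. rep_control v t $ 2) - integral {0..1} (control_x1 v), 0]"

lemma rep_line_control_AE: "AE t in lebesgue_on {0..1}. rep_control line_control t = vector [0, 1]"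
  unfolding line_control_def by (rule rep_abs_control_AE) simp

lemma integral_control_x1_bound: "\<bar>integral {0..1} (control_x1 v)\<bar> \<le> norm v"
proof -
  have "norm (integral {0..1} (control_x1 v)) \<le> integral {0..1} (\<lambda>_::real. norm v)"
    by (intro integral_norm_bound_integral integrable_continuous_real continuous_on_control_x1)
      (auto intro: abs_control_x1_le)
  then show ?thesis by simp
qed

lemma norm_vector_3_le: "norm (vector [a, b, c] :: real^3) \<le> \<bar>a\<bar> + \<bar>b\<bar> + \<bar>c\<bar>"
  using norm_le_l1_cart[of "vector [a, b, c] :: real^3"] by (simp add: sum_3 vector_3)

lemma bounded_linear_endpoint_deriv: "bounded_linear endpoint_deriv"
proof (rule bounded_linear_intro)
  fix v w :: control and r :: real
  have x1_on: "control_x1 v integrable_on {0..1}" for v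
    by (intro integrable_continuous_real continuous_on_control_x1)
  have "integral {0..1} (\<lambda>t. rep_control (v + w) t $ 2)
      = integral {0..1} (\<lambda>s. rep_control v s $ 2 + rep_control w s $ 2)"
    using rep_control_add_AE[of v w] by (intro integral_AE_cong[where a = 0 and b = 1]) (auto elim!: AE_mp)
  moreover have "integral {0..1} (control_x1 (v + w)) = integral {0..1} (\<lambda>t. control_x1 v t + control_x1 w t)"
    by (rule integral_cong) (simp add: control_x1_add)
  ultimately show "endpoint_deriv (v + w) = endpoint_deriv v + endpoint_deriv w"
    by (simp add: endpoint_deriv_def vec_eq_iff forall_3 vector_3 control_x1_add integral_add
        rep_control_nth_integrable_on x1_on)
  have "integral {0..1} (\<lambda>t. rep_control (r *\<^sub>R v) t $ 2) = integral {0..1} (\<lambda>s. r * rep_control v s $ 2)"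
    using rep_control_scaleR_AE[of r v] by (intro integral_AE_cong[where a = 0 and b = 1]) (auto elim!: AE_mp)
  moreover have "integral {0..1} (control_x1 (r *\<^sub>R v)) = integral {0..1} (\<lambda>t. r * control_x1 v t)"
    by (rule integral_cong) (simp add: control_x1_scaleR)
  ultimately show "endpoint_deriv (r *\<^sub>R v) = r *\<^sub>R endpoint_deriv v"
    by (simp add: endpoint_deriv_def vec_eq_iff forall_3 vector_3 control_x1_scaleR algebra_simps)
  have "norm (endpoint_deriv v) \<le> \<bar>control_x1 v 1\<bar> +
      \<bar>integral {0..1} (\<lambda>t. rep_control v t $ 2) - integral {0..1} (control_x1 v)\<bar> + \<bar>0\<bar>"
    unfolding endpoint_deriv_def by (rule norm_vector_3_le)
  also have "\<dots> \<le> norm v + (norm v + norm v)"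
    using abs_control_x1_le[of 1 v] integral_control_x1_bound[of v]
      abs_integral_rep_control_mult_le[of "\<lambda>_. 1" 1 v 2] by simp
  finally show "norm (endpoint_deriv v) \<le> norm v * 3" by simp
qed

text \<open>After subtracting the linear part the error is \<open>vector [0, - R2, R3]\<close>: one
  term bounded by the square of \<open>norm v\<close> in \<open>R2\<close> and two in
  \<open>R3\<close>, which explains the constant 3.\<close>

lemma has_derivative_endpoint_map:
  assumes "p \<ge> 2"
  shows "(endpoint_map p (gam 0) has_derivative endpoint_deriv) (at line_control)"
  unfolding has_derivative_at_alt
proof (intro conjI bounded_linear_endpoint_deriv allI impI)
  fix e :: real assume "e > 0"
  have remainder: "norm (endpoint_map p (gam 0) (line_control + v) - endpoint_map p (gam 0) line_control
      - endpoint_deriv v) \<le> 3 * norm v * norm v" if "norm v \<le> 1" for v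
  proof -
    have x_line: "control_x1 line_control t = 0" if "t \<in> {0..1}" for t
    proof -
      have "integral {0..t} (\<lambda>s. rep_control line_control s $ 1) = integral {0..t} (\<lambda>s. 0)"
        using rep_line_control_AE that
        by (intro integral_AE_cong[where a = 0 and b = 1]) (auto elim!: AE_mp simp: vector_2)
      then show ?thesis by (simp add: control_x1_def)
    qed
    have x: "control_x1 (line_control + v) t = control_x1 v t" if "t \<in> {0..1}" for t
      using that by (simp add: control_x1_add x_line)
    \<comment> \<open>The second component of the perturbed control is \<open>1 + v$2\<close> almost
      everywhere, so integrals against it split.\<close>
    have split: "integral {0..1} (\<lambda>t. rep_control (line_control + v) t $ 2 * g t)
        = integral {0..1} g + integral {0..1} (\<lambda>t. rep_control v t $ 2 * g t)"
      if g: "continuous_on {0..1} g" for g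
    proof -
      have "integral {0..1} (\<lambda>t. rep_control (line_control + v) t $ 2 * g t)
          = integral {0..1} (\<lambda>t. g t + rep_control v t $ 2 * g t)"
        using rep_control_add_AE[of line_control v] rep_line_control_AE
        by (intro integral_AE_cong[where a = 0 and b = 1]) (auto elim!: AE_mp simp: vector_2 algebra_simps)
      also have "\<dots> = integral {0..1} g + integral {0..1} (\<lambda>t. rep_control v t $ 2 * g t)"
        using g by (intro integral_add integrable_continuous_real rep_control_mult_integrable_on)
      finally show ?thesis .
    qed
    have line2: "integral {0..1} (\<lambda>t. rep_control line_control t $ 2 * g t) = integral {0..1} g" for g
      using rep_line_control_AE
      by (intro integral_AE_cong[where a = 0 and b = 1]) (auto elim!: AE_mp simp: vector_2)
    have xc: "continuous_on {0..1} (control_x1 v)" by (rule continuous_on_control_x1)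
    have F_line: "endpoint_map p (gam 0) line_control = vector [0, 1, 0]"
    proof -
      have "integral {0..1} (\<lambda>t. 1 - control_x1 line_control t) = integral {0..1} (\<lambda>t::real. 1)"
        by (rule integral_cong) (simp add: x_line)
      moreover have "integral {0..1} (\<lambda>t. control_x1 line_control t ^ p) = integral {0..1} (\<lambda>t::real. 0)"
        using assms by (intro integral_cong) (simp add: x_line)
      ultimately show ?thesis
        unfolding endpoint_map_gam_0 line2 by (simp add: x_line)
    qed
    define R2 where "R2 = integral {0..1} (\<lambda>t. rep_control v t $ 2 * control_x1 v t)"
    define R3 where "R3 = integral {0..1} (\<lambda>t. control_x1 v t ^ p) +
      integral {0..1} (\<lambda>t. rep_control v t $ 2 * control_x1 v t ^ p)"
    have "endpoint_map p (gam 0) (line_control + v) = vector [control_x1 v 1,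
      integral {0..1} (\<lambda>t. rep_control (line_control + v) t $ 2 * (1 - control_x1 v t)),
      integral {0..1} (\<lambda>t. rep_control (line_control + v) t $ 2 * control_x1 v t ^ p)]"
    proof -
      \<comment> \<open>The identity \<open>x\<close> holds on \<open>{0..1}\<close> only, so it is
        applied under the integral sign, for both integrands at once through
        \<open>G\<close>.\<close>
      have "integral {0..1} (\<lambda>t. a t * G (control_x1 (line_control + v) t))
          = integral {0..1} (\<lambda>t. a t * G (control_x1 v t))" for a G :: "real \<Rightarrow> real"
        by (rule integral_cong) (simp add: x)
      from this[where G = "\<lambda>r. 1 - r"] this[where G = "\<lambda>r. r ^ p"] show ?thesis
        unfolding endpoint_map_gam_0 by (simp add: x)
    qed
    also have "integral {0..1} (\<lambda>t. rep_control (line_control + v) t $ 2 * control_x1 v t ^ p) = R3"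
      unfolding R3_def by (intro split continuous_intros xc)
    also have "integral {0..1} (\<lambda>t. rep_control (line_control + v) t $ 2 * (1 - control_x1 v t))
      = 1 + integral {0..1} (\<lambda>t. rep_control v t $ 2) - integral {0..1} (control_x1 v) - R2"
    proof -
      have "integral {0..1} (\<lambda>t. 1 - control_x1 v t) = integral {0..1} (\<lambda>t::real. 1) - integral {0..1} (control_x1 v)"
        by (intro integral_diff integrable_continuous_real continuous_intros xc)
      moreover have "integral {0..1} (\<lambda>t. rep_control v t $ 2 * (1 - control_x1 v t))
          = integral {0..1} (\<lambda>t. rep_control v t $ 2 - rep_control v t $ 2 * control_x1 v t)"
        by (simp add: algebra_simps)
      moreover have "\<dots> = integral {0..1} (\<lambda>t. rep_control v t $ 2) - R2"
        unfolding R2_def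
        by (intro integral_diff rep_control_nth_integrable_on rep_control_mult_integrable_on xc) auto
      ultimately show ?thesis
        by (subst split) (auto intro!: continuous_intros xc)
    qed
    finally have "endpoint_map p (gam 0) (line_control + v) - endpoint_map p (gam 0) line_control
      - endpoint_deriv v = vector [0, - R2, R3]"
      by (simp add: F_line endpoint_deriv_def vec_eq_iff forall_3 vector_3)
    also have "norm \<dots> \<le> \<bar>0\<bar> + \<bar>- R2\<bar> + \<bar>R3\<bar>" by (rule norm_vector_3_le)
    also have "\<bar>- R2\<bar> \<le> norm v * norm v"
      unfolding R2_def abs_minus_cancel
      by (intro abs_integral_rep_control_mult_le xc) (simp add: abs_control_x1_le)
    also have "\<bar>R3\<bar> \<le> norm v * norm v + norm v * norm v"
    proof -
      have bound: "\<bar>control_x1 v t ^ p\<bar> \<le> norm v * norm v" if "t \<in> {0..1}" for t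
      proof -
        have "\<bar>control_x1 v t\<bar> \<le> norm v" using that by (simp add: abs_control_x1_le)
        then have "\<bar>control_x1 v t ^ p\<bar> \<le> norm v ^ p" by (simp add: power_abs power_mono)
        also have "\<dots> \<le> norm v ^ 2" using \<open>norm v \<le> 1\<close> assms by (intro power_decreasing) auto
        finally show ?thesis by (simp add: power2_eq_square)
      qed
      have "norm (integral {0..1} (\<lambda>t. control_x1 v t ^ p)) \<le> integral {0..1} (\<lambda>_::real. norm v * norm v)"
        by (intro integral_norm_bound_integral integrable_continuous_real continuous_intros xc)
          (auto intro: bound)
      moreover have "\<bar>integral {0..1} (\<lambda>t. rep_control v t $ 2 * control_x1 v t ^ p)\<bar> \<le> norm v * (norm v * norm v)"
        by (intro abs_integral_rep_control_mult_le continuous_intros xc bound)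
      moreover have "norm v * (norm v * norm v) \<le> norm v * norm v"
        using \<open>norm v \<le> 1\<close> by (simp add: mult_left_le_one_le)
      ultimately show ?thesis unfolding R3_def by simp
    qed
    finally show ?thesis by simp
  qed
  show "\<exists>d>0. \<forall>y. norm (y - line_control) < d \<longrightarrow>
      norm (endpoint_map p (gam 0) y - endpoint_map p (gam 0) line_control - endpoint_deriv (y - line_control))
      \<le> e * norm (y - line_control)"
  proof (intro exI conjI allI impI)
    show "min 1 (e / 3) > 0" using \<open>e > 0\<close> by simp
    fix y :: control assume y: "norm (y - line_control) < min 1 (e / 3)"
    then have "norm (endpoint_map p (gam 0) y - endpoint_map p (gam 0) line_control - endpoint_deriv (y - line_control))
      \<le> 3 * norm (y - line_control) * norm (y - line_control)"
      using remainder[of "y - line_control"] by simp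
    also have "\<dots> \<le> e * norm (y - line_control)"
      using y by (intro mult_right_mono) auto
    finally show "norm (endpoint_map p (gam 0) y - endpoint_map p (gam 0) line_control - endpoint_deriv (y - line_control))
      \<le> e * norm (y - line_control)" .
  qed
qed

section \<open>Directional derivatives of the length at the line\<close>

lemma J_line_control_add:
  assumes f: "integrable (lebesgue_on {0..1}) f"
  shows "J (line_control + h *\<^sub>R abs_control f) = L1_norm 0 1 (\<lambda>t. vector [0, 1] + h *\<^sub>R f t)"
proof -
  have "line_control + h *\<^sub>R abs_control f = abs_control (\<lambda>t. vector [0, 1] + h *\<^sub>R f t)"
    unfolding line_control_def using f
    by (simp add: plus_control.abs_eq scaleR_control.abs_eq L1_eq_def)
  then show ?thesis
    using f by (simp add: J_def norm_abs_control)
qed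

lemma J_line_control: "J line_control = 1"
  unfolding J_def line_control_def
  by (simp add: norm_abs_control L1_norm_def norm_vec_def L2_set_def sum_2 vector_2 measure_restrict_space)

text \<open>The perturbation is orthogonal to the line's control, so the speed becomes
  \<open>sqrt (1 + (h * f$1)\<^sup>2)\<close>, between 1 and \<open>1 + h\<^sup>2\<close>. The
  difference quotient is thus squeezed between 0 and \<open>h\<close>.\<close>

lemma dJ_line_control_transversal:
  assumes f: "integrable (lebesgue_on {0..1}) f"
    and f2: "\<And>t. f t $ 2 = 0" and f1: "\<And>t. t \<in> {0..1} \<Longrightarrow> \<bar>f t $ 1\<bar> \<le> 1"
  shows "dJ line_control (abs_control f) = 0"
proof -
  have i: "integrable (lebesgue_on {0..1}) (\<lambda>t. vector [0, 1] + h *\<^sub>R f t)" for h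
    using f by (intro Bochner_Integration.integrable_add integrable_scaleR_right) auto
  have n: "norm (vector [0, 1] + h *\<^sub>R f t) = sqrt (1 + (h * f t $ 1)\<^sup>2)" for h t
    by (simp add: norm_vec_def L2_set_def sum_2 vector_2 f2 add.commute)
  have lower: "1 \<le> J (line_control + h *\<^sub>R abs_control f)" for h
    using has_integral_le[OF has_integral_const_real[of 1 0 1] L1_norm_conv_integral[OF i[of h]]]
    by (simp add: J_line_control_add[OF f] n)
  have upper: "J (line_control + h *\<^sub>R abs_control f) \<le> 1 + h\<^sup>2" for h
  proof -
    have "norm (vector [0, 1] + h *\<^sub>R f t) \<le> 1 + h\<^sup>2" if "t \<in> {0..1}" for t
    proof -
      have "(f t $ 1)\<^sup>2 \<le> 1" using f1[OF that] by (simp add: abs_square_le_1)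
      then have "h\<^sup>2 * (f t $ 1)\<^sup>2 \<le> h\<^sup>2 * 1" by (intro mult_left_mono) auto
      then have "1 + (h * f t $ 1)\<^sup>2 \<le> 1 + h\<^sup>2" by (simp add: power_mult_distrib)
      also have "\<dots> \<le> (1 + h\<^sup>2)\<^sup>2" by (simp add: power2_sum)
      finally show ?thesis unfolding n by (intro real_le_lsqrt) auto
    qed
    then show ?thesis
      using has_integral_le[OF L1_norm_conv_integral[OF i[of h]] has_integral_const_real[of "1 + h\<^sup>2" 0 1]]
      by (simp add: J_line_control_add[OF f])
  qed
  have "((\<lambda>h. (J (line_control + h *\<^sub>R abs_control f) - J line_control) / h) \<longlongrightarrow> 0) (at_right 0)"
  proof (rule tendsto_sandwich)
    show "\<forall>\<^sub>F h in at_right 0. 0 \<le> (J (line_control + h *\<^sub>R abs_control f) - J line_control) / h"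
      using lower by (auto simp: eventually_at_right_less J_line_control intro: eventually_mono[OF eventually_at_right_less])
    show "\<forall>\<^sub>F h in at_right 0. (J (line_control + h *\<^sub>R abs_control f) - J line_control) / h \<le> h"
    proof (rule eventually_mono[OF eventually_at_right_less])
      fix h :: real assume "0 < h"
      then show "(J (line_control + h *\<^sub>R abs_control f) - J line_control) / h \<le> h"
        using upper[of h] by (simp add: J_line_control divide_le_eq power2_eq_square)
    qed
  qed (auto intro!: tendsto_eq_intros)
  then show ?thesis
    unfolding dJ_def by (intro tendsto_Lim) auto
qed

text \<open>By homogeneity of the norm the difference quotient is constantly 1 for
  \<open>h > 0\<close>.\<close>

lemma dJ_line_control_self: "dJ line_control line_control = 1"
proof -
  have "J (line_control + h *\<^sub>R line_control) = \<bar>1 + h\<bar> * J line_control" for h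
    by (simp add: J_def flip: norm_scaleR scaleR_add_left) (simp add: scaleR_add_left)
  then have "\<forall>\<^sub>F h in at_right 0. (J (line_control + h *\<^sub>R line_control) - J line_control) / h = 1"
    by (intro eventually_mono[OF eventually_at_right_less]) (simp add: J_line_control)
  then have "((\<lambda>h. (J (line_control + h *\<^sub>R line_control) - J line_control) / h) \<longlongrightarrow> 1) (at_right 0)"
    by (rule tendsto_eventually)
  then show ?thesis
    unfolding dJ_def by (intro tendsto_Lim) auto
qed

section \<open>Test variations and the multipliers of the line\<close>

lemma endpoint_deriv_abs_control:
  assumes f: "integrable (lebesgue_on {0..1}) f"
    and F: "\<And>t. t \<in> {0..1} \<Longrightarrow> ((\<lambda>s. f s $ 1) has_integral F t) {0..t}"
    and G: "(F has_integral A) {0..1}" and B: "((\<lambda>t. f t $ 2) has_integral B) {0..1}"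
  shows "endpoint_deriv (abs_control f) = vector [F 1, B - A, 0]"
proof -
  have rep: "integral {0..t} (\<lambda>s. rep_control (abs_control f) s $ i) = integral {0..t} (\<lambda>s. f s $ i)"
    if "t \<le> 1" for t i
    using rep_abs_control_AE[OF f] that
    by (intro integral_AE_cong[where a = 0 and b = 1]) (auto elim!: AE_mp)
  have x: "control_x1 (abs_control f) t = F t" if "t \<in> {0..1}" for t
    using that F by (simp add: control_x1_def rep integral_unique)
  then have "integral {0..1} (control_x1 (abs_control f)) = A"
    using G by (subst integral_cong[where g = F]) (auto simp: integral_unique)
  then show ?thesis
    using B x[of 1] rep[of 1 2] by (simp add: endpoint_deriv_def integral_unique)
qed

theorem strictly_singular_extremal_gam:
  assumes "p \<ge> 2"
  shows "strictly_singular_extremal p gam"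
  unfolding strictly_singular_extremal_def extremal_def
proof (intro exI conjI ballI)
  have d: "d_ext_endpoint p (gam 0) line_control v = (endpoint_deriv v, dJ line_control v)" for v
    using frechet_derivative_at[OF has_derivative_endpoint_map[OF assms]]
    by (simp add: d_ext_endpoint_def)
  show "horizontal p 0 1 gam (rep_control line_control)"
    using assms by (intro horizontal_gam integrable_rep_control rep_line_control_AE) auto
  \<comment> \<open>The covector \<open>dx\<^sub>3\<close> annihilates the image because the third
    entry of \<open>endpoint_deriv\<close> is 0.\<close>
  define z :: "(real^3) \<Rightarrow>\<^sub>L real" where "z = Blinfun (\<lambda>x. x $ 3)"
  have z: "blinfun_apply z x = x $ 3" for x
    unfolding z_def by (simp add: bounded_linear_Blinfun_apply bounded_linear_vec_nth)
  have "z \<noteq> 0"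
    using z[of "axis 3 1"] by auto
  then have "(z, 0) \<noteq> (0 :: ((real^3) \<Rightarrow>\<^sub>L real) \<times> real)"
    by (simp add: zero_prod_def)
  moreover have "(z, 0) \<in> multipliers p (gam 0) line_control"
    by (auto simp: annihilator_def d z endpoint_deriv_def vector_3)
  ultimately show "\<exists>m\<in>multipliers p (gam 0) line_control. m \<noteq> 0" by blast
  fix lm assume "lm \<in> multipliers p (gam 0) line_control"
  then obtain l l0 where lm: "lm = (l, l0)"
    and ann: "blinfun_apply l (endpoint_deriv v) + l0 * dJ line_control v = 0" for v
    by (cases lm) (auto simp: annihilator_def d)
  \<comment> \<open>Only the first two coefficients of \<open>l\<close> are visible, again since the
    third entry of the derivative vanishes.\<close>
  define A B where "A = blinfun_apply l (axis 1 1)" and "B = blinfun_apply l (axis 2 1)"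
  have l: "blinfun_apply l (vector [a, b, 0]) = a * A + b * B" for a b
  proof -
    have "vector [a, b, 0] = a *\<^sub>R axis 1 1 + b *\<^sub>R (axis 2 1 :: real^3)"
      by (simp add: vec_eq_iff forall_3 vector_3 axis_def)
    then show ?thesis by (simp add: A_def B_def blinfun.add_right blinfun.scaleR_right)
  qed
  have int: "integrable (lebesgue_on {0..1}) (\<lambda>t. vector [g t, c] :: real^2)"
    if "continuous_on {0..1} g" for g :: "real \<Rightarrow> real" and c
  proof -
    have "integrable (lebesgue_on {0..1}) (\<lambda>t. (vector [g t, c] :: real^2) $ i)" for i
      using exhaust_2[of i] continuous_imp_integrable_real[OF that] by (auto simp: vector_2)
    then show ?thesis by (subst integrable_iff_component) auto
  qed
  \<comment> \<open>The variations \<open>(1, 0)\<close> and \<open>(t, 0)\<close> leave the length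
    stationary and so give equations without \<open>l0\<close>. Their first coordinates
    \<open>t\<close> and \<open>t\<^sup>2 / 2\<close> yield two independent equations, so
    \<open>A = B = 0\<close>.\<close>
  have "A - B / 2 = 0"
  proof -
    let ?f = "\<lambda>t::real. vector [1, 0] :: real^2"
    have f: "integrable (lebesgue_on {0..1}) ?f" by simp
    have "endpoint_deriv (abs_control ?f) = vector [1, 0 - 1 / 2, 0]"
    proof (rule endpoint_deriv_abs_control[OF f, where F = "\<lambda>t. t"])
      show "((\<lambda>s. ?f s $ 1) has_integral t) {0..t}" if "t \<in> {0..1}" for t
        using has_integral_const_real[of "1::real" 0 t] that by (simp add: vector_2)
      show "((\<lambda>t. t) has_integral (1 / 2 :: real)) {0..1}"
        using ident_has_integral[of 0 "1::real"] by simp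
    qed (simp add: vector_2)
    moreover have "dJ line_control (abs_control ?f) = 0"
      by (rule dJ_line_control_transversal[OF f]) (simp_all add: vector_2)
    ultimately show ?thesis
      using ann[of "abs_control ?f"] l[of 1 "- 1 / 2"] by simp
  qed
  moreover have "A / 2 - B / 6 = 0"
  proof -
    let ?f = "\<lambda>t::real. vector [t, 0] :: real^2"
    have f: "integrable (lebesgue_on {0..1}) ?f" by (intro int continuous_intros)
    have "endpoint_deriv (abs_control ?f) = vector [1\<^sup>2 / 2, 0 - 1 / 6, 0]"
    proof (rule endpoint_deriv_abs_control[OF f, where F = "\<lambda>t. t\<^sup>2 / 2"])
      show "((\<lambda>s. ?f s $ 1) has_integral t\<^sup>2 / 2) {0..t}" if "t \<in> {0..1}" for t
        using ident_has_integral[of 0 t] that by (simp add: vector_2)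
      have "((\<lambda>t. t\<^sup>2 / 2) has_integral (1^3 / 6 - 0^3 / 6 :: real)) {0..1}"
        by (rule fundamental_theorem_of_calculus)
          (auto intro!: derivative_eq_intros simp flip: has_real_derivative_iff_has_vector_derivative
            simp: power2_eq_square)
      then show "((\<lambda>t. t\<^sup>2 / 2) has_integral (1 / 6 :: real)) {0..1}" by simp
    qed (simp add: vector_2)
    moreover have "dJ line_control (abs_control ?f) = 0"
      by (rule dJ_line_control_transversal[OF f]) (simp_all add: vector_2)
    ultimately show ?thesis
      using ann[of "abs_control ?f"] l[of "1 / 2" "- 1 / 6"] by simp
  qed
  \<comment> \<open>The variation along the line itself changes the length at rate 1 and so ties
    \<open>l0\<close> to \<open>B\<close>.\<close>
  moreover have "B + l0 = 0"
  proof -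
    let ?f = "\<lambda>t::real. vector [0, 1] :: real^2"
    have f: "integrable (lebesgue_on {0..1}) ?f" by simp
    have "endpoint_deriv line_control = vector [0, 1 - 0, 0]"
      unfolding line_control_def
    proof (rule endpoint_deriv_abs_control[OF f, where F = "\<lambda>t. 0"])
      show "((\<lambda>t. ?f t $ 2) has_integral 1) {0..1}"
        using has_integral_const_real[of "1::real" 0 1] by (simp add: vector_2)
    qed (simp_all add: vector_2)
    then show ?thesis
      using ann[of line_control] l[of 0 1] by (simp add: dJ_line_control_self)
  qed
  ultimately show "case lm of (l, l0) \<Rightarrow> l0 = 0"
    by (simp add: lm)
qed

theorem theorem1p3:
  fixes p :: nat
  assumes "p \<ge> 1"
  shows "(p \<ge> 2 \<longrightarrow> strictly_singular_extremal p gam)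
    \<and> (even p \<longrightarrow> locally_length_minimizing p {0..1} gam)
    \<and> (p = 3 \<longrightarrow> \<not> locally_length_minimizing p {0..1} gam)"
  using assms strictly_singular_extremal_gam locally_length_minimizing_gam
    not_locally_length_minimizing_gam by blast

end
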